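(* Let $f,g:\mathbb R^n\to\mathbb R$ be two integrable log-concave functions with full-dimensional supports and continuous when restricted to them. Then $$\int_{\mathbb R^n}\sqrt{f(x)\bar g(x)}\,dx\int_{\mathbb R^n}f\oplus g(x)\,dx\leq 2^n\int_{\mathbb R^n}f(x)\,dx\int_{\mathbb R^n}g(x)\,dx.$$ Equality holds if and only if the following two conditions are satisfied: (i) $\mathrm{supp}\,f=\mathrm{supp}\,\bar g$ is a translation of a cone $C$ with vertex at $0$ with simplicial section, and (ii) $f(x)=c_1e^{-\langle a,x\rangle}$ on $\mathrm{supp}\,f$ and $g(x)=c_2e^{-\langle b,x\rangle}$ on $\mathrm{supp}\,g$ for some $c_1,c_2>0$ and some $a,b\in\mathbb R^n$ such that $\langle a,x\rangle\geq0\geq\langle b,x\rangle$ for every $x\in C$.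
   Context: A function $f:\mathbb R^n\to[0,\infty)$ is log-concave if $f=e^{-u}$ for a convex $u:\mathbb R^n\to(-\infty,\infty]$. $\bar g(x)=g(-x)$. For log-concave $f,g$, $f\oplus g(z):=\sup_{x+y=2z}\sqrt{f(x)g(y)}$. $\mathrm{supp}$ denotes the support of a function. *)

theory Defs
  imports "HOL-Analysis.Analysis"
begin

text \<open>Log-concave: f = exp(-u) with u convex, extended-valued (u = +infinity outside
  its effective domain D, which is a convex set).\<close>
definition log_concave :: "('a::euclidean_space \<Rightarrow> real) \<Rightarrow> bool" where
  "log_concave f \<longleftrightarrow> (\<exists>D u. convex D \<and> convex_on D u \<and>
      (\<forall>x. f x = (if x \<in> D then exp (- u x) else 0)))"

definition refl_fun :: "('a::euclidean_space \<Rightarrow> real) \<Rightarrow> 'a \<Rightarrow> real" where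
  "refl_fun g x = g (- x)"

definition lc_oplus :: "('a::euclidean_space \<Rightarrow> real) \<Rightarrow> ('a \<Rightarrow> real) \<Rightarrow> 'a \<Rightarrow> real" where
  "lc_oplus f g z = (SUP x. sqrt (f x * g (2 *\<^sub>R z - x)))"

definition supp :: "('a::euclidean_space \<Rightarrow> real) \<Rightarrow> 'a set" where
  "supp f = closure {x. f x \<noteq> 0}"

definition simplicial_cone :: "'a::euclidean_space set \<Rightarrow> bool" where
  "simplicial_cone C \<longleftrightarrow> (\<exists>V. independent V \<and> card V = DIM('a) \<and>
      C = {\<Sum>v\<in>V. l v *\<^sub>R v | l. \<forall>v\<in>V. l v \<ge> 0})"

end

theory Submission
  imports Defs
begin

text \<open>Write \<open>k x = g (- x)\<close>. Log-concavity gives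
  \<open>sqrt (f x * k (x - 2 z)) * sqrt (f w * k w) \<le> f ((x + w) / 2) * k ((x + w) / 2 - z)\<close>;
  integrating over \<open>w\<close>, taking the supremum over \<open>x\<close> and integrating over \<open>z\<close> yields the inequality.

  In the equality case semicontinuity turns the almost everywhere equalities into equalities for
  every \<open>z\<close> and \<open>w\<close>. For \<open>z = 0\<close> they say that the common support is \<open>p + C\<close> for a
  convex cone \<open>C\<close>, where \<open>p\<close> maximises \<open>f k\<close>, and for general \<open>z\<close> that
  \<open>f u * k (u - z)\<close> is a multiple of the translate of \<open>f k\<close> that moves \<open>p\<close> to a point \<open>Q z\<close>,
  with \<open>Q (2 z) - p = 2 (Q z - p)\<close>. For \<open>z \<in> - C\<close> the decay of \<open>f\<close> at infinity forces \<open>Q z = p\<close>.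
  Hence \<open>f\<close> and \<open>k\<close> have the same support and are log-affine on it, and any
  two translates of \<open>C\<close> meet in a translate of \<open>C\<close>; so \<open>C\<close> is a lattice cone, and lattice cones are
  simplicial.\<close>

section \<open>Log-concave functions that decay at infinity\<close>

text \<open>The factor \<open>2 ^ n\<close> is the Jacobian of the midpoint map
  \<open>w \<mapsto> (x + w) / 2\<close>. The obstacle is that \<open>f\<close> and \<open>k\<close>
  may jump to 0 at the boundary of their supports. Convexity helps twice: the boundary is null, and
  a closed convex set with interior is the closure of its interior, so an identity valid almost
  everywhere still fixes supports and boundary values. The equality case yields relations between
  displacements \<open>c\<close> and \<open>2 c\<close>. They become rigid through one recurring
  argument: superlevel sets are bounded, so a function cannot stay above a positive constant at all
  \<open>p + 2 ^ j c\<close> unless \<open>c = 0\<close>. For \<open>z\<close> in \<open>- C\<close>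
  it is applied to \<open>c = p - Q z\<close>; the lower bound for \<open>f\<close> comes from
  comparing three points \<open>p - d\<close>, \<open>p\<close>, \<open>p + d\<close> and cancelling
  \<open>k\<close> by midpoint concavity. Once \<open>Q z = p\<close>, moving the argument of
  \<open>k\<close> by \<open>- z\<close> rescales \<open>f k\<close> by a constant, which is a ratio
  of values of \<open>k\<close>; so \<open>k\<close> is multiplicative along \<open>C\<close>, and
  log-concavity makes its logarithm linear there. Exchanging \<open>f\<close> and \<open>k\<close>
  gives the same for \<open>f\<close>.\<close>

locale decaying_log_concave =
  fixes f :: "'a::euclidean_space \<Rightarrow> real" and K :: "'a set"
  assumes closed: "closed K" and convex: "convex K" and interior: "interior K \<noteq> {}"
    and cont: "continuous_on K f"
    and nonneg: "0 \<le> f x"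
    and zero: "x \<notin> K \<Longrightarrow> f x = 0"
    and pos: "x \<in> interior K \<Longrightarrow> 0 < f x"
    and log_concave: "0 \<le> t \<Longrightarrow> t \<le> 1 \<Longrightarrow>
      f x powr (1 - t) * f y powr t \<le> f ((1 - t) *\<^sub>R x + t *\<^sub>R y)"
    and bounded_superlevel: "0 < c \<Longrightarrow> bounded {x. c \<le> f x}"
    and measurable [measurable]: "f \<in> borel_measurable borel"
    and finite_integral: "(\<integral>\<^sup>+ x. ennreal (f x) \<partial>lborel) < \<infinity>"
begin

lemma in_support: "0 < f x \<Longrightarrow> x \<in> K"
  using zero by force

lemma midpoint_le: "f x * f y \<le> (f ((1/2) *\<^sub>R (x + y)))\<^sup>2"
proof -
  have "f x powr (1/2) * f y powr (1/2) \<le> f ((1/2) *\<^sub>R x + (1/2) *\<^sub>R y)"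
    using log_concave[of "1/2" x y] by simp
  then have "sqrt (f x * f y) \<le> f ((1/2) *\<^sub>R (x + y))"
    by (simp add: powr_half_sqrt nonneg real_sqrt_mult scaleR_add_right)
  then have "(sqrt (f x * f y))\<^sup>2 \<le> (f ((1/2) *\<^sub>R (x + y)))\<^sup>2"
    using nonneg by (intro power_mono) auto
  then show ?thesis
    by (simp add: nonneg)
qed

lemma closure_positive: "closure {x. 0 < f x} = K"
proof
  show "closure {x. 0 < f x} \<subseteq> K"
    using in_support closed by (intro closure_minimal) auto
  have "K = closure (interior K)"
    using convex_closure_interior[OF convex interior] closed by simp
  also have "\<dots> \<subseteq> closure {x. 0 < f x}"
    using pos by (intro closure_mono) auto
  finally show "K \<subseteq> closure {x. 0 < f x}" .
qed

lemma closed_superlevel: assumes "0 < c" shows "closed {x. c \<le> f x}"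
proof -
  have "{x. c \<le> f x} = {x \<in> K. c \<le> f x}"
    using in_support assms by force
  moreover have "closed {x \<in> K. c \<le> f x}"
    using continuous_on_closed_Collect_le[OF continuous_on_const cont closed] by simp
  ultimately show ?thesis by simp
qed

lemma compact_superlevel: "0 < c \<Longrightarrow> compact {x. c \<le> f x}"
  using closed_superlevel bounded_superlevel compact_eq_bounded_closed by blast

lemma bounded_above: obtains B where "0 < B" "\<And>x. f x \<le> B"
proof -
  have "compact (f ` {x. 1 \<le> f x})"
    using in_support
    by (intro compact_continuous_image compact_superlevel continuous_on_subset[OF cont]) force+
  then have "bdd_above (f ` {x. 1 \<le> f x})"
    by (intro bounded_imp_bdd_above compact_imp_bounded)
  then obtain B where B: "\<And>x. 1 \<le> f x \<Longrightarrow> f x \<le> B"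
    by (auto simp: bdd_above_def)
  show thesis
  proof (rule that[of "max 1 B"])
    show "f x \<le> max 1 B" for x
      using B[of x] by linarith
  qed simp
qed

text \<open>The points \<open>p + 2 ^ j c\<close> would be unbounded inside a bounded superlevel
  set. This excludes a second peak, a moving centre, lines in the cone and exponential
  growth.\<close>

lemma dyadic_ray_bounded_below_imp_zero:
  assumes "0 < \<epsilon>" "\<And>j::nat. \<epsilon> \<le> f (p + (2 ^ j) *\<^sub>R c)"
  shows "c = 0"
proof (rule ccontr)
  assume "c \<noteq> 0"
  obtain R where R: "\<And>x. \<epsilon> \<le> f x \<Longrightarrow> norm x \<le> R"
    using bounded_superlevel[OF assms(1)] by (auto simp: bounded_iff)
  obtain j :: nat where j: "(R + norm p) / norm c < 2 ^ j"
    using real_arch_pow[of 2] by auto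
  have "norm ((2 ^ j) *\<^sub>R c) \<le> norm (p + (2 ^ j) *\<^sub>R c) + norm p"
    using norm_triangle_ineq4[of "p + (2 ^ j) *\<^sub>R c" p] by simp
  also have "\<dots> \<le> R + norm p"
    using R assms(2) by simp
  finally show False
    using j \<open>c \<noteq> 0\<close> by (simp add: field_simps)
qed

text \<open>Substitute for continuity at boundary points of \<open>K\<close>: only limits along
  sequences inside \<open>K\<close> are controlled.\<close>

lemma tendsto_in_support:
  assumes "\<And>j. X j \<in> K" "X \<longlonglongrightarrow> x"
  shows "(\<lambda>j. f (X j)) \<longlonglongrightarrow> f x"
proof -
  have "x \<in> K"
    using closed assms closed_sequentially by blast
  then show ?thesis
    using cont assms by (auto simp: continuous_on_sequentially o_def)
qed

end

locale log_concave_pair =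
  f: decaying_log_concave f K + k: decaying_log_concave k L
  for f k :: "'a::euclidean_space \<Rightarrow> real" and K L :: "'a set"
begin

lemma swap: "log_concave_pair k f L K"
  by unfold_locales

end

section \<open>Pairs for which all translates give the same profile\<close>

text \<open>The pointwise form of the equality case: \<open>k\<close> is the reflection of \<open>g\<close>, and \<open>p\<close> is the
  maximiser of \<open>f k\<close>.\<close>

locale rigid_pair = log_concave_pair f k K L
  for f k :: "'a::euclidean_space \<Rightarrow> real" and K L :: "'a set" +
  fixes p :: 'a
  assumes interior_Int: "interior (K \<inter> L) \<noteq> {}"
    and peak_pos: "0 < f p * k p"
    and peak_max: "\<And>y. f y * k y \<le> f p * k p"
    and peak_eq: "\<And>u. (f u * k u)\<^sup>2 = (f p * k p) * (f (2 *\<^sub>R u - p) * k (2 *\<^sub>R u - p))"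
    and rigid: "\<And>y z. 0 < f y * k (y - 2 *\<^sub>R z) \<Longrightarrow>
      \<exists>x. (\<forall>y. f y * k (y - 2 *\<^sub>R z) \<le> f x * k (x - 2 *\<^sub>R z)) \<and>
        (\<forall>u. (f u * k (u - z))\<^sup>2 =
              (f x * k (x - 2 *\<^sub>R z)) * (f (2 *\<^sub>R u - x) * k (2 *\<^sub>R u - x)))"
begin

definition H where "H x = f x * k x"
text \<open>The common support seen from the peak. Nothing in the definition makes it a cone; that
  is a consequence of \<open>H_double\<close>.\<close>

definition C where "C = {c. p + c \<in> K \<inter> L}"

lemma H_nonneg: "0 \<le> H x"
  by (simp add: H_def f.nonneg k.nonneg)

lemma H_peak_pos: "0 < H p"
  using peak_pos by (simp add: H_def)

text \<open>This is \<open>peak_eq\<close> centred at \<open>p\<close>: where \<open>H\<close> is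
  positive, the logarithm of \<open>H / H p\<close> doubles with the displacement from
  \<open>p\<close>.\<close>

lemma H_double: "(H (p + c))\<^sup>2 = H p * H (p + 2 *\<^sub>R c)"
proof -
  have "2 *\<^sub>R (p + c) - p = p + 2 *\<^sub>R c"
    by (simp add: algebra_simps scaleR_2)
  then show ?thesis
    using peak_eq[of "p + c"] by (simp add: H_def)
qed

lemma f_pos_if_H: "0 < H x \<Longrightarrow> 0 < f x" and k_pos_if_H: "0 < H x \<Longrightarrow> 0 < k x"
  using f.nonneg[of x] k.nonneg[of x] by (auto simp: H_def zero_less_mult_iff)

lemma in_C_if_H: "0 < H (p + c) \<Longrightarrow> c \<in> C"
  using f.in_support k.in_support f_pos_if_H k_pos_if_H by (auto simp: C_def)

lemma convex_C: "convex C"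
proof -
  have "C = (+) (- p) ` (K \<inter> L)"
    by (force simp: C_def image_iff)
  then show ?thesis
    using f.convex k.convex by (simp only: convex_translation convex_Int)
qed

lemma closed_C: "closed C"
proof -
  have "C = (+) (- p) ` (K \<inter> L)"
    by (force simp: C_def image_iff)
  then show ?thesis
    using f.closed k.closed by (simp only: closed_translation closed_Int)
qed

lemma interior_C: "interior C \<noteq> {}"
proof -
  have "C = (+) (- p) ` (K \<inter> L)"
    by (force simp: C_def image_iff)
  then show ?thesis
    using interior_Int interior_translation[of "- p" "K \<inter> L"] by simp
qed

lemma zero_in_C: "0 \<in> C"
  using in_C_if_H[of 0] H_peak_pos by simp

lemma half_in_C: "c \<in> C \<Longrightarrow> (1 / 2 ^ j) *\<^sub>R c \<in> C"
  using convexD[OF convex_C zero_in_C, of c "1 - 1/2^j" "1/2^j"] by simp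

text \<open>If \<open>f k\<close> vanished at \<open>p + c\<close>, it would vanish at all \<open>p + c / 2 ^ j\<close>, hence at \<open>p\<close>.\<close>

lemma H_pos: assumes "c \<in> C" shows "0 < H (p + c)"
proof (rule ccontr)
  assume "\<not> 0 < H (p + c)"
  then have z: "H (p + c) = 0"
    using H_nonneg[of "p + c"] by simp
  have "H (p + (1 / 2 ^ j) *\<^sub>R c) = 0" for j
  proof (induction j)
    case (Suc j)
    have "(H (p + (1 / 2 ^ Suc j) *\<^sub>R c))\<^sup>2 = H p * H (p + (1 / 2 ^ j) *\<^sub>R c)"
      using H_double[of "(1 / 2 ^ Suc j) *\<^sub>R c"] by simp
    then show ?case using Suc by simp
  qed (use z in simp)
  moreover have "(\<lambda>j. H (p + (1 / 2 ^ j) *\<^sub>R c)) \<longlonglongrightarrow> H p"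
  proof -
    have "(\<lambda>j. (1 / 2) ^ j) \<longlonglongrightarrow> (0::real)"
      by (rule LIMSEQ_realpow_zero) auto
    then have "(\<lambda>j. p + (1 / 2 ^ j) *\<^sub>R c) \<longlonglongrightarrow> p + 0 *\<^sub>R c"
      by (intro tendsto_intros) (simp add: power_one_over)
    then have "(\<lambda>j. p + (1 / 2 ^ j) *\<^sub>R c) \<longlonglongrightarrow> p"
      by simp
    moreover have "p + (1 / 2 ^ j) *\<^sub>R c \<in> K" "p + (1 / 2 ^ j) *\<^sub>R c \<in> L" for j
      using half_in_C[OF assms, of j] by (auto simp: C_def)
    ultimately show ?thesis
      unfolding H_def by (intro tendsto_mult f.tendsto_in_support k.tendsto_in_support)
  qed
  ultimately have "H p = 0"
    by (simp add: LIMSEQ_const_iff)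
  then show False using H_peak_pos by simp
qed

lemma H_pos_iff: "0 < H (p + c) \<longleftrightarrow> c \<in> C"
  using H_pos in_C_if_H by blast

text \<open>\<open>H_double\<close> carries positivity outwards. With convexity and
  \<open>0 \<in> C\<close> this turns \<open>C\<close> into a cone.\<close>

lemma double_in_C: "c \<in> C \<Longrightarrow> 2 *\<^sub>R c \<in> C"
  using H_double[of c] H_pos[of c] H_peak_pos by (metis H_pos_iff zero_less_mult_pos zero_less_power)

lemma power2_in_C: "c \<in> C \<Longrightarrow> (2 ^ j) *\<^sub>R c \<in> C"
  by (induction j) (use double_in_C in \<open>force simp flip: scaleR_scaleR\<close>)+

lemma scale_in_C: assumes "c \<in> C" "0 \<le> t" shows "t *\<^sub>R c \<in> C"
proof -
  obtain j :: nat where j: "t < 2 ^ j"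
    using real_arch_pow[of 2 t] by auto
  have "(1 - t / 2 ^ j) *\<^sub>R 0 + (t / 2 ^ j) *\<^sub>R ((2 ^ j) *\<^sub>R c) \<in> C"
    using j assms by (intro convexD[OF convex_C zero_in_C power2_in_C]) auto
  then show ?thesis by simp
qed

lemma add_in_C: assumes "c \<in> C" "d \<in> C" shows "c + d \<in> C"
proof -
  have "2 *\<^sub>R ((1/2) *\<^sub>R c + (1/2) *\<^sub>R d) \<in> C"
    using assms by (intro double_in_C convexD[OF convex_C]) auto
  then show ?thesis by (simp add: scaleR_add_right)
qed

text \<open>A cone with interior satisfies \<open>C - C = UNIV\<close>: a large multiple of an inner
  ball swallows the perturbation \<open>x\<close>.\<close>

lemma absorb: obtains e where "e \<in> C" "x + e \<in> C"
proof -
  obtain e r where e: "0 < r" "ball e r \<subseteq> C"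
    using interior_C by (meson all_not_in_conv mem_interior)
  define s where "s = (norm x + 1) / r"
  have s: "0 < s" using e by (auto simp: s_def intro!: divide_pos_pos add_nonneg_pos)
  have "norm ((1/s) *\<^sub>R x) < r"
    using s e by (auto simp: s_def field_simps add_pos_nonneg)
  then have "e + (1/s) *\<^sub>R x \<in> C"
    using e(2) by (auto simp: dist_norm)
  then have "s *\<^sub>R (e + (1/s) *\<^sub>R x) \<in> C"
    using s by (intro scale_in_C) auto
  then have "x + s *\<^sub>R e \<in> C"
    using s by (simp add: scaleR_add_right add.commute)
  moreover have "s *\<^sub>R e \<in> C"
    using e s by (intro scale_in_C) auto
  ultimately show thesis using that by blast
qed

lemma f_pos: "c \<in> C \<Longrightarrow> 0 < f (p + c)" and k_pos: "c \<in> C \<Longrightarrow> 0 < k (p + c)"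
  using H_pos f_pos_if_H k_pos_if_H by blast+

text \<open>A second maximum would be reproduced by \<open>H_double\<close> at every
  \<open>p + 2 ^ j c\<close>; as \<open>k\<close> is bounded, \<open>f\<close> would not decay along
  this ray.\<close>

lemma peak_unique: assumes "H p \<le> H x" shows "x = p"
proof -
  define c where "c = x - p"
  have "H (p + (2 ^ j) *\<^sub>R c) = H p" for j
  proof (induction j)
    case 0
    then show ?case
      using assms peak_max[of x] by (simp add: H_def c_def)
  next
    case (Suc j)
    have "(H p)\<^sup>2 = H p * H (p + (2 ^ Suc j) *\<^sub>R c)"
      using H_double[of "(2 ^ j) *\<^sub>R c"] Suc by simp
    then show ?case
      using H_peak_pos by (simp add: power2_eq_square)
  qed
  moreover obtain B where B: "0 < B" "\<And>x. k x \<le> B"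
    using k.bounded_above by blast
  ultimately have "H p \<le> f (p + (2 ^ j) *\<^sub>R c) * B" for j
    using mult_left_mono[OF B(2)[of "p + (2 ^ j) *\<^sub>R c"] f.nonneg[of "p + (2 ^ j) *\<^sub>R c"]]
    by (simp add: H_def)
  then have "H p / B \<le> f (p + (2 ^ j) *\<^sub>R c)" for j
    using B(1) by (simp add: divide_le_eq)
  then have "c = 0"
    using f.dyadic_ray_bounded_below_imp_zero[of "H p / B" p c] H_peak_pos B by auto
  then show ?thesis by (simp add: c_def)
qed

text \<open>Both \<open>Q (2 z)\<close> and \<open>2 Q z - p\<close> maximise \<open>f u k (u - 2 z)\<close>, which forces \<open>Q (2 z) - p = 2 (Q z - p)\<close>.\<close>

lemma translates:
  obtains Q A where "\<And>z. 0 < A z" "\<And>z u. f u * k (u - z) = A z * H (p + (u - Q z))"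
    "\<And>z. Q (2 *\<^sub>R z) = 2 *\<^sub>R Q z - p"
proof -
  have "\<exists>q \<alpha>. 0 < \<alpha> \<and> (\<forall>u. f u * k (u - z) = \<alpha> * H (p + (u - q))) \<and>
      (\<forall>y. f y * k (y - 2 *\<^sub>R z) \<le> f (2 *\<^sub>R q - p) * k (2 *\<^sub>R q - p - 2 *\<^sub>R z))" for z
  proof -
    obtain e where e: "e \<in> C" "- (2 *\<^sub>R z) + e \<in> C"
      using absorb by blast
    have pos: "0 < f (p + e) * k (p + e - 2 *\<^sub>R z)"
      using f_pos[OF e(1)] k_pos[OF e(2)] by (simp add: algebra_simps)
    then obtain x where x: "\<And>y. f y * k (y - 2 *\<^sub>R z) \<le> f x * k (x - 2 *\<^sub>R z)"
      "\<And>u. (f u * k (u - z))\<^sup>2 = (f x * k (x - 2 *\<^sub>R z)) * H (2 *\<^sub>R u - x)"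
      using rigid[OF pos] unfolding H_def by blast
    define S where "S = f x * k (x - 2 *\<^sub>R z)"
    have S: "0 < S" using x(1)[of "p + e"] pos by (simp add: S_def)
    \<comment> \<open>\<open>x\<close> is a maximiser for the shift \<open>2 z\<close>; its midpoint
      with \<open>p\<close> is the centre for the shift \<open>z\<close>, because
      \<open>2 u - x = p + 2 (u - q)\<close>. \<open>H_double\<close> then turns the identity for
      squares into one with factor \<open>S / H p\<close>.\<close>
    define q where "q = (1/2) *\<^sub>R (x + p)"
    have xq: "x = 2 *\<^sub>R q - p" by (simp add: q_def)
    define \<alpha> where "\<alpha> = sqrt (S / H p)"
    have \<alpha>: "0 < \<alpha>" using S H_peak_pos by (simp add: \<alpha>_def)
    have "f u * k (u - z) = \<alpha> * H (p + (u - q))" for u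
    proof -
      have "2 *\<^sub>R u - x = p + 2 *\<^sub>R (u - q)"
        by (simp add: xq algebra_simps)
      then have "(f u * k (u - z))\<^sup>2 = S * H (p + 2 *\<^sub>R (u - q))"
        using x(2)[of u] by (simp add: S_def)
      also have "\<dots> = (S / H p) * (H (p + (u - q)))\<^sup>2"
        using H_double[of "u - q"] H_peak_pos by simp
      also have "\<dots> = (\<alpha> * H (p + (u - q)))\<^sup>2"
        using S H_peak_pos by (simp add: \<alpha>_def power_mult_distrib)
      finally show ?thesis
        using \<alpha> H_nonneg f.nonneg k.nonneg by (simp add: power2_eq_iff_nonneg)
    qed
    then show ?thesis using \<alpha> x(1) unfolding xq by blast
  qed
  then obtain Q A where QA: "\<And>z. 0 < A z" "\<And>z u. f u * k (u - z) = A z * H (p + (u - Q z))"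
    "\<And>z y. f y * k (y - 2 *\<^sub>R z) \<le> f (2 *\<^sub>R Q z - p) * k (2 *\<^sub>R Q z - p - 2 *\<^sub>R z)"
    by metis
  have "Q (2 *\<^sub>R z) = 2 *\<^sub>R Q z - p" for z
  proof -
    \<comment> \<open>Maximality is tested against the point \<open>Q (2 z)\<close>, where the
      profile takes its peak value \<open>H p\<close>.\<close>
    have "A (2 *\<^sub>R z) * H p \<le> A (2 *\<^sub>R z) * H (2 *\<^sub>R Q z - Q (2 *\<^sub>R z))"
      using QA(3)[of "Q (2 *\<^sub>R z)" z] unfolding QA(2) by simp
    then have "H p \<le> H (2 *\<^sub>R Q z - Q (2 *\<^sub>R z))"
      using QA(1) by simp
    then show ?thesis
      using peak_unique by (metis diff_diff_eq2 add_diff_cancel_left')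
  qed
  with QA show thesis using that by blast
qed

text \<open>It suffices that \<open>Q (- e) = p\<close>, since the profile for the shift
  \<open>- e\<close> is then \<open>H\<close> itself up to a constant.\<close>

lemma shift_by_C:
  assumes "e \<in> C" shows "\<exists>\<alpha>>0. \<forall>u. f u * k (u + e) = \<alpha> * (f u * k u)"
proof -
  obtain Q A where QA: "\<And>z. 0 < A z" "\<And>z u. f u * k (u - z) = A z * H (p + (u - Q z))"
    "\<And>z. Q (2 *\<^sub>R z) = 2 *\<^sub>R Q z - p"
    using translates by metis
  \<comment> \<open>The displacement of the centre; the rule
    \<open>Q (2 z) - p = 2 (Q z - p)\<close> multiplies it by \<open>2 ^ j\<close> when
    \<open>e\<close> is replaced by \<open>2 ^ j e\<close>.\<close>
  define c where "c = p - Q (- e)"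
  have "0 < f p * k (p - (- e))"
    using f_pos[OF zero_in_C] k_pos[OF assms] by simp
  then have "0 < H (p + c)"
    unfolding QA(2) c_def using QA(1)[of "- e"] by (simp add: zero_less_mult_iff)
  then have c: "c \<in> C"
    by (rule in_C_if_H)
  have Qj: "Q (- ((2 ^ j) *\<^sub>R e)) = p - (2 ^ j) *\<^sub>R c" for j
  proof (induction j)
    case (Suc j)
    have "Q (- ((2 ^ Suc j) *\<^sub>R e)) = Q (2 *\<^sub>R (- ((2 ^ j) *\<^sub>R e)))"
      by simp
    then show ?case
      by (simp only: QA(3) Suc) (simp add: algebra_simps scaleR_2)
  qed (simp add: c_def)
  obtain B where B: "0 < B" "\<And>x. f x \<le> B"
    using f.bounded_above by blast
  have fp: "0 < f p" using f_pos[OF zero_in_C] by simp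
  have "(f p)\<^sup>2 / B \<le> f (p + (2 ^ j) *\<^sub>R c)" for j :: nat
  proof -
    define z where "z = - ((2 ^ j) *\<^sub>R e)"
    define d where "d = (2 ^ j) *\<^sub>R c"
    have eq: "f u * k (u - z) = A z * H (u + d)" for u
      using QA(2)[of u z] Qj[of j] by (simp add: z_def d_def algebra_simps)
    have kp: "0 < k (p - z)"
      using k_pos[OF power2_in_C[OF assms, of j]] by (simp add: z_def)
    have "(f p)\<^sup>2 * (k (p - z))\<^sup>2 = (A z)\<^sup>2 * (H (p + d))\<^sup>2"
      using eq[of p] by (simp add: power_mult_distrib[symmetric])
    \<comment> \<open>\<open>H_double\<close> splits the square at \<open>p + d\<close> into the
      values at \<open>p\<close> and \<open>p + 2 d\<close>, which by \<open>eq\<close> belong to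
      the arguments \<open>p - d\<close> and \<open>p + d\<close>.\<close>
    also have "\<dots> = (A z * H p) * (A z * H (p + d + d))"
      unfolding H_double by (simp add: power2_eq_square scaleR_2 add.assoc)
    also have "\<dots> = (f (p - d) * k (p - d - z)) * (f (p + d) * k (p + d - z))"
      unfolding eq by simp
    also have "\<dots> = (f (p - d) * f (p + d)) * (k (p - d - z) * k (p + d - z))"
      by (simp add: algebra_simps)
    \<comment> \<open>Concavity of \<open>k\<close> at the midpoint \<open>p - z\<close> lets the
      factor \<open>k\<close> cancel, leaving a statement about \<open>f\<close> alone.\<close>
    also have "\<dots> \<le> (f (p - d) * f (p + d)) * (k (p - z))\<^sup>2"
    proof -
      have "(1/2) *\<^sub>R ((p - d - z) + (p + d - z)) = p - z"
        by (simp add: algebra_simps scaleR_add_right[symmetric] scaleR_half_double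
            flip: scaleR_2)
      then show ?thesis
        using k.midpoint_le[of "p - d - z" "p + d - z"] f.nonneg by (intro mult_left_mono) auto
    qed
    finally have "(f p)\<^sup>2 \<le> f (p - d) * f (p + d)"
      using kp by simp
    also have "\<dots> \<le> B * f (p + d)"
      using B f.nonneg by (intro mult_right_mono) auto
    finally show ?thesis
      using B by (simp add: d_def field_simps)
  qed
  then have "c = 0"
    using f.dyadic_ray_bounded_below_imp_zero[of "(f p)\<^sup>2 / B" p c] B fp by auto
  then have "Q (- e) = p" by (simp add: c_def)
  then show ?thesis
    using QA(1)[of "- e"] QA(2)[of _ "- e"] by (auto simp: H_def)
qed

text \<open>Where \<open>f u > 0\<close>, a large shift \<open>e\<close> brings \<open>u + e\<close>
  into the region where \<open>k\<close> is positive; proportionality then gives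
  \<open>k u \<noteq> 0\<close>.\<close>

lemma K_subset: "K \<subseteq> L"
proof -
  have "{x. 0 < f x} \<subseteq> L"
  proof clarify
    fix u assume u: "0 < f u"
    obtain e where e: "e \<in> C" "(u - p) + e \<in> C"
      using absorb by blast
    have "0 < f u * k (u + e)"
      using u k_pos[OF e(2)] by simp
    then show "u \<in> L"
      using shift_by_C[OF e(1)] u k.zero by force
  qed
  then show ?thesis
    using f.closure_positive closure_minimal k.closed by metis
qed

text \<open>The constant of \<open>shift_by_C\<close> is \<open>k (p + e) / k p\<close>, read off at
  \<open>u = p\<close>; the claim is the same identity at \<open>u = p + c\<close>.\<close>

lemma k_multiplicative:
  assumes "c \<in> C" "e \<in> C" shows "k p * k (p + (c + e)) = k (p + c) * k (p + e)"
proof -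
  obtain \<alpha> where \<alpha>: "\<And>u. f u * k (u + e) = \<alpha> * (f u * k u)"
    using shift_by_C[OF assms(2)] by blast
  have "k (p + e) = \<alpha> * k p"
    using \<alpha>[of p] f_pos[OF zero_in_C] by simp
  moreover have "k (p + c + e) = \<alpha> * k (p + c)"
    using \<alpha>[of "p + c"] f_pos[OF assms(1)] by simp
  ultimately show ?thesis
    by (simp add: add.assoc)
qed

text \<open>Both supports are now \<open>p + C\<close>, and the product
  \<open>f u * k (u - z)\<close> is positive exactly on a translate of \<open>C\<close>. Thus
  \<open>C \<inter> (z + C) = q + C\<close>.\<close>

lemma translates_of_C: assumes "L \<subseteq> K" shows "\<exists>q. \<forall>u. u \<in> C \<and> u - z \<in> C \<longleftrightarrow> u - q \<in> C"
proof -
  obtain Q A where QA: "\<And>z. 0 < A z" "\<And>z u. f u * k (u - z) = A z * H (p + (u - Q z))"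
    using translates by metis
  have f: "0 < f (p + c) \<longleftrightarrow> c \<in> C" and k: "0 < k (p + c) \<longleftrightarrow> c \<in> C" for c
    using f_pos[of c] k_pos[of c] f.in_support[of "p + c"] k.in_support[of "p + c"] assms K_subset
    unfolding C_def by blast+
  have "u \<in> C \<and> u - z \<in> C \<longleftrightarrow> u - (Q z - p) \<in> C" for u
  proof -
    have "u \<in> C \<and> u - z \<in> C \<longleftrightarrow> 0 < f (p + u) * k (p + u - z)"
      using f[of u] k[of "u - z"] f.nonneg[of "p + u"] by (auto simp: zero_less_mult_iff add_diff_eq)
    also have "\<dots> \<longleftrightarrow> u - (Q z - p) \<in> C"
      unfolding QA(2) using QA(1)[of z] H_pos_iff[of "p + u - Q z"]
      by (simp add: zero_less_mult_iff algebra_simps)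
    finally show ?thesis .
  qed
  then show ?thesis by blast
qed

end

section \<open>Lattice cones are simplicial\<close>

text \<open>For the order with positive cone \<open>C\<close>, \<open>lattice_C\<close> says that
  \<open>q\<close> is the least upper bound of \<open>0\<close> and \<open>z\<close>; suprema of
  arbitrary pairs follow by translation.\<close>

locale lattice_cone =
  fixes C :: "'a::euclidean_space set"
  assumes closed_C: "closed C" and nonempty_interior: "interior C \<noteq> {}"
    and zero_C: "0 \<in> C" and add_C: "x \<in> C \<Longrightarrow> y \<in> C \<Longrightarrow> x + y \<in> C"
    and scale_C: "x \<in> C \<Longrightarrow> 0 \<le> t \<Longrightarrow> t *\<^sub>R x \<in> C"
    and pointed_C: "x \<in> C \<Longrightarrow> - x \<in> C \<Longrightarrow> x = 0"
    and lattice_C: "\<exists>q. \<forall>u. u \<in> C \<and> u - z \<in> C \<longleftrightarrow> u - q \<in> C"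
begin

text \<open>In the order \<open>x \<le> y \<longleftrightarrow> y - x \<in> C\<close>, take \<open>x2 = sup 0 (x - y1)\<close>.\<close>

lemma riesz_decomposition:
  assumes "x \<in> C" "y2 \<in> C" "y1 \<in> C" "y1 + y2 - x \<in> C"
  obtains x1 x2 where "x = x1 + x2" "x1 \<in> C" "x2 \<in> C" "y1 - x1 \<in> C" "y2 - x2 \<in> C"
proof -
  obtain q where q: "\<And>u. u \<in> C \<and> u - (x - y1) \<in> C \<longleftrightarrow> u - q \<in> C"
    using lattice_C by blast
  have "q \<in> C" "q - (x - y1) \<in> C"
    using q[of q] zero_C by auto
  moreover have "y2 - q \<in> C"
    using q[of y2] assms by (simp add: algebra_simps)
  moreover have "x - q \<in> C"
    using q[of x] assms by simp
  ultimately show thesis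
    by (intro that[of "x - q" q]) (auto simp: algebra_simps)
qed

text \<open>Pointedness makes \<open>C - {0}\<close> convex, so the compact hull of the unit vectors
  of \<open>C\<close> misses 0 and can be strictly separated from it.\<close>

lemma positive_functional: obtains a where "\<And>x. x \<in> C \<Longrightarrow> x \<noteq> 0 \<Longrightarrow> 0 < a \<bullet> x"
proof -
  have cv: "convex (C - {0})"
  proof (rule convexI)
    fix x y and u v :: real
    assume xy: "x \<in> C - {0}" "y \<in> C - {0}" and uv: "0 \<le> u" "0 \<le> v" "u + v = 1"
    have "u *\<^sub>R x + v *\<^sub>R y \<noteq> 0"
    proof
      assume eq: "u *\<^sub>R x + v *\<^sub>R y = 0"
      then have "- (u *\<^sub>R x) = v *\<^sub>R y"
        by (simp add: minus_unique)
      then have "u *\<^sub>R x = 0"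
        using xy uv by (intro pointed_C) (auto simp: scale_C)
      moreover have "v *\<^sub>R y = 0"
        using eq calculation by simp
      ultimately show False
        using xy uv by auto
    qed
    then show "u *\<^sub>R x + v *\<^sub>R y \<in> C - {0}"
      using xy uv by (auto intro: add_C scale_C)
  qed
  let ?S = "convex hull (C \<inter> sphere 0 1)"
  have "?S \<subseteq> C - {0}"
    by (rule hull_minimal) (use cv in auto)
  then have "0 \<notin> ?S" by blast
  moreover have "compact ?S"
    by (intro compact_convex_hull closed_Int_compact closed_C compact_sphere)
  ultimately obtain a b where ab: "0 < b" "\<And>x. x \<in> ?S \<Longrightarrow> b < a \<bullet> x"
    using separating_hyperplane_closed_0[of ?S] compact_imp_closed convex_convex_hull by blast
  show thesis
  proof (rule that[of a])
    fix x assume x: "x \<in> C" "x \<noteq> 0"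
    then have "(1 / norm x) *\<^sub>R x \<in> C \<inter> sphere 0 1"
      by (auto intro: scale_C)
    then have "b < a \<bullet> ((1 / norm x) *\<^sub>R x)"
      by (intro ab hull_inc)
    then show "0 < a \<bullet> x"
      using ab(1) x by (simp add: field_simps) (smt (verit) mult_pos_pos zero_less_norm_iff)
  qed
qed

text \<open>The slice \<open>a \<bullet> x = 1\<close> is a compact base of \<open>C\<close>, hence
  the hull of its extreme points. Riesz decomposition makes these linearly independent, and the
  interior of \<open>C\<close> forces them to span.\<close>

theorem simplicial: "simplicial_cone C"
proof -
  obtain a where a: "\<And>x. x \<in> C \<Longrightarrow> x \<noteq> 0 \<Longrightarrow> 0 < a \<bullet> x"
    using positive_functional by blast
  have a0: "0 \<le> a \<bullet> x" if "x \<in> C" for x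
    using a[OF that] by (cases "x = 0") auto
  define B where "B = C \<inter> {x. a \<bullet> x = 1}"
  have convex_C: "convex C"
    by (rule convexI) (auto intro: add_C scale_C)
  have convex_B: "convex B"
    unfolding B_def by (intro convex_Int convex_C convex_hyperplane)
  have base: "(1 / (a \<bullet> x)) *\<^sub>R x \<in> B" if "x \<in> C" "x \<noteq> 0" for x
    using a[OF that] that by (auto simp: B_def intro: scale_C)
  have "compact B"
  proof -
    have "compact (C \<inter> sphere 0 1)"
      by (intro closed_Int_compact closed_C compact_sphere)
    moreover have "a \<bullet> x \<noteq> 0" if "x \<in> C \<inter> sphere 0 1" for x
      using a[of x] that by force
    ultimately have "compact ((\<lambda>x. (1 / (a \<bullet> x)) *\<^sub>R x) ` (C \<inter> sphere 0 1))"
      by (intro compact_continuous_image continuous_intros) auto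
    moreover have "B = (\<lambda>x. (1 / (a \<bullet> x)) *\<^sub>R x) ` (C \<inter> sphere 0 1)"
    proof
      show "B \<subseteq> (\<lambda>x. (1 / (a \<bullet> x)) *\<^sub>R x) ` (C \<inter> sphere 0 1)"
      proof
        fix x assume x: "x \<in> B"
        then have "x \<noteq> 0" by (auto simp: B_def)
        then show "x \<in> (\<lambda>x. (1 / (a \<bullet> x)) *\<^sub>R x) ` (C \<inter> sphere 0 1)"
          using x by (intro image_eqI[of _ _ "(1 / norm x) *\<^sub>R x"]) (auto simp: B_def intro: scale_C)
      qed
    qed (use base in force)
    ultimately show ?thesis by simp
  qed
  define E where "E = {x. x extreme_point_of B}"
  have hull: "B = convex hull E"
    unfolding E_def using Krein_Milman_Minkowski[OF \<open>compact B\<close> convex_B] .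
  have EB: "E \<subseteq> B"
    by (auto simp: E_def extreme_point_of_def)
  have EC: "v \<in> C" "a \<bullet> v = 1" if "v \<in> E" for v
    using EB that by (auto simp: B_def)
  \<comment> \<open>An extreme point of the base generates an extreme ray: rescaling
    \<open>x\<close> and \<open>l v - x\<close> into \<open>B\<close> writes \<open>v\<close> as a
    convex combination of two points of \<open>B\<close>.\<close>
  have atom: "x = (a \<bullet> x) *\<^sub>R v" if v: "v \<in> E" and x: "x \<in> C" "l *\<^sub>R v - x \<in> C" for v x l
  proof (cases "x = 0 \<or> l *\<^sub>R v - x = 0")
    case True
    then show ?thesis using EC[OF v] by auto
  next
    case False
    define y where "y = l *\<^sub>R v - x"
    have pos: "0 < a \<bullet> x" "0 < a \<bullet> y"
      using False a x by (auto simp: y_def)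
    have l: "l = a \<bullet> x + a \<bullet> y"
      using EC[OF v] by (simp add: y_def inner_diff_right)
    define x' y' where "x' = (1 / (a \<bullet> x)) *\<^sub>R x" and "y' = (1 / (a \<bullet> y)) *\<^sub>R y"
    have B: "x' \<in> B" "y' \<in> B"
      unfolding x'_def y'_def using base False x by (auto simp: y_def)
    have "l *\<^sub>R v = (a \<bullet> x) *\<^sub>R x' + (a \<bullet> y) *\<^sub>R y'"
      using pos by (simp add: x'_def y'_def) (simp add: y_def)
    then have "(1/l) *\<^sub>R (l *\<^sub>R v) = (1/l) *\<^sub>R ((a \<bullet> x) *\<^sub>R x' + (a \<bullet> y) *\<^sub>R y')"
      by simp
    then have vv: "v = ((a \<bullet> x) / l) *\<^sub>R x' + ((a \<bullet> y) / l) *\<^sub>R y'"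
      using l pos by (simp add: scaleR_add_right)
    have "x' = v"
    proof (cases "x' = y'")
      case True
      then show ?thesis
        using vv l pos by (simp add: add_divide_distrib[symmetric] flip: scaleR_add_left)
    next
      case False
      have "v \<in> open_segment x' y'"
        unfolding in_segment using False vv l pos
        by (intro conjI exI[of _ "(a \<bullet> y) / l"]) (auto simp: field_simps)
      then show ?thesis
        using v B by (auto simp: E_def extreme_point_of_def)
    qed
    then show ?thesis
      using pos by (auto simp: x'_def)
  qed
  have sum_C: "(\<Sum>w\<in>T. b w *\<^sub>R w) \<in> C" if "finite T" "T \<subseteq> E" "\<And>w. w \<in> T \<Longrightarrow> 0 \<le> b w" for T b
    using that by (induction T rule: finite_induct) (auto simp: zero_C add_C scale_C EC)
  \<comment> \<open>Riesz decomposition splits off the part \<open>x1\<close> of \<open>l v\<close>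
    lying below \<open>b w w\<close>. By \<open>atom\<close> it is a multiple of both
    \<open>v\<close> and \<open>w\<close>, so it vanishes or \<open>v = w\<close>; the rest is
    handled by induction.\<close>
  have dominated: "l = 0 \<or> v \<in> T"
    if "finite T" "T \<subseteq> E" "v \<in> E" "\<And>w. w \<in> T \<Longrightarrow> 0 \<le> b w" "0 \<le> l" "(\<Sum>w\<in>T. b w *\<^sub>R w) - l *\<^sub>R v \<in> C"
    for T v l and b :: "'a \<Rightarrow> real"
    using that
  proof (induction T arbitrary: l rule: finite_induct)
    case empty
    then have "l *\<^sub>R v = 0"
      by (intro pointed_C) (auto intro: scale_C EC)
    then show ?case using EC[of v] empty by auto
  next
    case (insert w T)
    have "l *\<^sub>R v \<in> C" "b w *\<^sub>R w \<in> C" "(\<Sum>w\<in>T. b w *\<^sub>R w) \<in> C"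
      using insert by (auto simp: scale_C EC sum_C)
    moreover have "b w *\<^sub>R w + (\<Sum>w\<in>T. b w *\<^sub>R w) - l *\<^sub>R v \<in> C"
      using insert by simp
    ultimately obtain x1 x2 where x: "l *\<^sub>R v = x1 + x2" "x1 \<in> C" "x2 \<in> C" "b w *\<^sub>R w - x1 \<in> C"
      "(\<Sum>w\<in>T. b w *\<^sub>R w) - x2 \<in> C"
      using riesz_decomposition[of "l *\<^sub>R v" "\<Sum>w\<in>T. b w *\<^sub>R w" "b w *\<^sub>R w"] by blast
    have x1: "x1 = (a \<bullet> x1) *\<^sub>R v" and x2: "x2 = (a \<bullet> x2) *\<^sub>R v" and "x1 = (a \<bullet> x1) *\<^sub>R w"
      using atom[of v x1 l] atom[of v x2 l] atom[of w x1 "b w"] insert.prems x by simp_all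
    then have "(a \<bullet> x1) *\<^sub>R v = (a \<bullet> x1) *\<^sub>R w"
      by simp
    then have "a \<bullet> x1 = 0 \<or> v = w" by auto
    moreover have "a \<bullet> x2 = 0 \<or> v \<in> T"
      using insert x x2 a0 by (intro insert.IH) auto
    moreover have "l = a \<bullet> x1 + a \<bullet> x2"
      using arg_cong[OF x(1), of "\<lambda>x. a \<bullet> x"] EC insert.prems by (simp add: inner_add_right)
    ultimately show ?case by auto
  qed
  have indep: "independent E"
  proof
    assume "dependent E"
    then obtain T u where T: "finite T" "T \<subseteq> E" "(\<Sum>v\<in>T. u v *\<^sub>R v) = 0" "\<exists>v\<in>T. u v \<noteq> 0"
      unfolding dependent_explicit by blast
    \<comment> \<open>Moving the negative coefficients to the other side, \<open>s v v\<close> is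
      dominated by a combination over \<open>N\<close>, although \<open>v\<close> is not in
      \<open>N\<close>.\<close>
    have nopos: False if sum: "(\<Sum>v\<in>T. s v *\<^sub>R v) = 0" and v: "v \<in> T" "0 < s v"
      for s :: "'a \<Rightarrow> real" and v
    proof -
      define N where "N = {w \<in> T. s w < 0}"
      have "(\<Sum>w\<in>T - N. s w *\<^sub>R w) + (\<Sum>w\<in>N. s w *\<^sub>R w) = 0"
        using sum T(1) by (subst sum.subset_diff[symmetric]) (auto simp: N_def)
      then have "- (\<Sum>w\<in>N. s w *\<^sub>R w) = (\<Sum>w\<in>T - N. s w *\<^sub>R w)"
        by (intro minus_unique) (simp add: add.commute)
      moreover have "(\<Sum>w\<in>T - N. s w *\<^sub>R w) = s v *\<^sub>R v + (\<Sum>w\<in>T - N - {v}. s w *\<^sub>R w)"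
        using T(1) v by (intro sum.remove) (auto simp: N_def)
      ultimately have "(\<Sum>w\<in>N. (- s w) *\<^sub>R w) - s v *\<^sub>R v = (\<Sum>w\<in>T - N - {v}. s w *\<^sub>R w)"
        by (simp add: sum_negf)
      moreover have "\<dots> \<in> C"
        using T by (intro sum_C) (auto simp: N_def)
      ultimately have "s v = 0 \<or> v \<in> N"
        using T v by (intro dominated[of N v "\<lambda>w. - s w"]) (auto simp: N_def)
      then show False using v by (auto simp: N_def)
    qed
    obtain v where "v \<in> T" "u v \<noteq> 0" using T by blast
    then show False
      using nopos[OF T(3), of v] nopos[of "\<lambda>w. - u w" v] T(3) by (force simp: sum_negf)
  qed
  \<comment> \<open>Finiteness of the set of extreme points is a consequence of independence; from
    here on convex hulls are finite sums.\<close>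
  then have finE: "finite E"
    using independent_imp_finite by blast
  have C_eq: "C = {\<Sum>v\<in>E. l v *\<^sub>R v | l. \<forall>v\<in>E. l v \<ge> 0}"
  proof
    show "C \<subseteq> {\<Sum>v\<in>E. l v *\<^sub>R v | l. \<forall>v\<in>E. l v \<ge> 0}"
    proof
      fix x assume x: "x \<in> C"
      show "x \<in> {\<Sum>v\<in>E. l v *\<^sub>R v | l. \<forall>v\<in>E. l v \<ge> 0}"
      proof (cases "x = 0")
        case True
        then show ?thesis by (auto intro!: exI[of _ "\<lambda>_. 0"])
      next
        case False
        then obtain u where u: "\<forall>v\<in>E. 0 \<le> u v" "(\<Sum>v\<in>E. u v *\<^sub>R v) = (1 / (a \<bullet> x)) *\<^sub>R x"
          using base[OF x False] unfolding hull convex_hull_finite[OF finE] by blast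
        have "x = (a \<bullet> x) *\<^sub>R ((1 / (a \<bullet> x)) *\<^sub>R x)"
          using a[OF x False] by simp
        also have "\<dots> = (\<Sum>v\<in>E. ((a \<bullet> x) * u v) *\<^sub>R v)"
          unfolding u(2)[symmetric] by (simp add: scaleR_sum_right)
        finally show ?thesis
          using u(1) a0[OF x] unfolding mem_Collect_eq by (intro exI[of _ "\<lambda>v. (a \<bullet> x) * u v"]) simp
      qed
    qed
  qed (use sum_C finE in auto)
  have "C \<subseteq> span E"
  proof
    fix x assume "x \<in> C"
    then obtain l where "x = (\<Sum>v\<in>E. l v *\<^sub>R v)"
      unfolding C_eq by blast
    then show "x \<in> span E"
      by (simp add: span_sum span_scale span_base)
  qed
  then have "interior (span E) \<noteq> {}"
    using nonempty_interior interior_mono by blast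
  then have "span E = UNIV"
    by (metis empty_interior_lowdim dim_eq_full dim_span dim_subset_UNIV less_le)
  then have "card E = DIM('a)"
    using dim_eq_card[OF _ indep, of UNIV] by simp
  then show ?thesis
    unfolding simplicial_cone_def using indep C_eq by blast
qed

end

lemma simplicial_cone_scale: "simplicial_cone C \<Longrightarrow> x \<in> C \<Longrightarrow> 0 \<le> t \<Longrightarrow> t *\<^sub>R x \<in> C"
  unfolding simplicial_cone_def
proof (elim exE conjE)
  fix V
  assume t: "0 \<le> t" and x: "x \<in> C" and C: "C = {\<Sum>v\<in>V. l v *\<^sub>R v | l. \<forall>v\<in>V. l v \<ge> 0}"
  obtain l where l: "x = (\<Sum>v\<in>V. l v *\<^sub>R v)" "\<forall>v\<in>V. l v \<ge> 0"
    using x C by blast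
  have "t *\<^sub>R x = (\<Sum>v\<in>V. (t * l v) *\<^sub>R v)"
    by (simp add: l scaleR_sum_right)
  moreover have "\<forall>v\<in>V. t * l v \<ge> 0"
    using l t by simp
  ultimately show "t *\<^sub>R x \<in> C"
    unfolding C mem_Collect_eq by (intro exI[of _ "\<lambda>v. t * l v"]) simp
qed

section \<open>Multiplicative functions on a cone\<close>

context decaying_log_concave
begin

text \<open>On a line in \<open>C\<close> the values at \<open>p + t d\<close> and
  \<open>p - t d\<close> have product \<open>(f p)\<^sup>2\<close>; since one is bounded above, the
  other is bounded below and cannot decay.\<close>

lemma multiplicative_imp_pointed:
  assumes "0 < f p" and scale: "\<And>c t. c \<in> C \<Longrightarrow> 0 \<le> t \<Longrightarrow> t *\<^sub>R c \<in> C"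
    and mult: "\<And>c e. c \<in> C \<Longrightarrow> e \<in> C \<Longrightarrow> f p * f (p + (c + e)) = f (p + c) * f (p + e)"
    and d: "d \<in> C" "- d \<in> C"
  shows "d = 0"
proof -
  obtain B where B: "0 < B" "\<And>x. f x \<le> B"
    using bounded_above by blast
  have "(f p)\<^sup>2 / B \<le> f (p + (2 ^ j) *\<^sub>R d)" for j :: nat
  proof -
    have "(f p)\<^sup>2 = f (p + (2 ^ j) *\<^sub>R d) * f (p + (2 ^ j) *\<^sub>R (- d))"
      using mult[OF scale[OF d(1), of "2 ^ j"] scale[OF d(2), of "2 ^ j"]]
      by (simp add: power2_eq_square)
    also have "\<dots> \<le> f (p + (2 ^ j) *\<^sub>R d) * B"
      using B nonneg by (intro mult_left_mono) auto
    finally show ?thesis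
      using B by (simp add: divide_le_eq)
  qed
  then show ?thesis
    using dyadic_ray_bounded_below_imp_zero[of "(f p)\<^sup>2 / B" p d] B assms(1) by auto
qed

text \<open>The logarithm \<open>l\<close> is additive on \<open>C\<close>. Concavity bounds
  \<open>l (t c)\<close> and \<open>l ((1 - t) c)\<close> below by \<open>t * l c\<close> and
  \<open>(1 - t) * l c\<close>, while additivity fixes their sum, so both bounds are attained and
  \<open>l\<close> is linear. Decay gives the sign of \<open>a\<close>.\<close>

lemma multiplicative_imp_exponential:
  assumes C: "simplicial_cone C" and add: "\<And>c d. c \<in> C \<Longrightarrow> d \<in> C \<Longrightarrow> c + d \<in> C"
    and fpos: "\<And>c. c \<in> C \<Longrightarrow> 0 < f (p + c)"
    and mult: "\<And>c e. c \<in> C \<Longrightarrow> e \<in> C \<Longrightarrow> f p * f (p + (c + e)) = f (p + c) * f (p + e)"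
  obtains a where "\<And>c. c \<in> C \<Longrightarrow> f (p + c) = f p * exp (- (a \<bullet> c))" "\<And>c. c \<in> C \<Longrightarrow> 0 \<le> a \<bullet> c"
proof -
  note scale = simplicial_cone_scale[OF C]
  obtain V where V: "independent V" "card V = DIM('a)"
    and CV: "C = {\<Sum>v\<in>V. l v *\<^sub>R v | l. \<forall>v\<in>V. l v \<ge> 0}"
    using C by (auto simp: simplicial_cone_def)
  have zero_C: "0 \<in> C" by (auto simp: CV intro!: exI[of _ "\<lambda>_. 0"])
  have finV: "finite V" using V independent_imp_finite by blast
  have VC: "v \<in> C" if "v \<in> V" for v
    unfolding CV using that finV
    by (auto intro!: exI[of _ "\<lambda>w. if w = v then 1 else 0"] simp: if_distrib[of "\<lambda>x. x *\<^sub>R _"] cong: if_cong)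
  have fp: "0 < f p" using fpos[OF zero_C] by simp
  define l where "l c = ln (f (p + c)) - ln (f p)" for c
  have l_add: "l (c + d) = l c + l d" if "c \<in> C" "d \<in> C" for c d
  proof -
    have "ln (f p * f (p + (c + d))) = ln (f (p + c) * f (p + d))"
      using mult[OF that] by simp
    then show ?thesis
      using fp fpos[OF that(1)] fpos[OF that(2)] fpos[OF add[OF that]] by (simp add: l_def ln_mult)
  qed
  have l_conc: "t * l c \<le> l (t *\<^sub>R c)" if "c \<in> C" "0 \<le> t" "t \<le> 1" for c t
  proof -
    have "f p powr (1 - t) * f (p + c) powr t \<le> f (p + t *\<^sub>R c)"
      using log_concave[OF that(2,3), of p "p + c"] by (simp add: algebra_simps)
    then have "ln (f p powr (1 - t) * f (p + c) powr t) \<le> ln (f (p + t *\<^sub>R c))"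
      using fp fpos[OF that(1)] fpos[OF scale[OF that(1,2)]] by (subst ln_le_cancel_iff) auto
    then show ?thesis
      using fp fpos[OF that(1)] by (simp add: l_def ln_mult ln_powr algebra_simps)
  qed
  have l1: "l (t *\<^sub>R c) = t * l c" if "c \<in> C" "0 \<le> t" "t \<le> 1" for c t
  proof -
    have "l c = l (t *\<^sub>R c) + l ((1 - t) *\<^sub>R c)"
      using l_add[of "t *\<^sub>R c" "(1 - t) *\<^sub>R c"] scale that by (simp flip: scaleR_add_left)
    then show ?thesis
      using l_conc[OF that] l_conc[of c "1 - t"] that by (simp add: algebra_simps)
  qed
  have l_scale: "l (t *\<^sub>R c) = t * l c" if "c \<in> C" "0 \<le> t" for c t
  proof (cases "t \<le> 1")
    case False
    then show ?thesis
      using l1[of "t *\<^sub>R c" "1 / t"] scale that by (simp add: field_simps)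
  qed (use l1 that in auto)
  have l_sum: "(\<Sum>v\<in>W. b v *\<^sub>R v) \<in> C \<and> l (\<Sum>v\<in>W. b v *\<^sub>R v) = (\<Sum>v\<in>W. b v * l v)"
    if "finite W" "W \<subseteq> V" "\<And>v. v \<in> W \<Longrightarrow> 0 \<le> b v" for W b
    using that
    by (induction W rule: finite_induct) (auto simp: zero_C l_def[of 0] l_add l_scale scale VC add)
  \<comment> \<open>\<open>- l\<close> is prescribed on the independent generators; \<open>a\<close>
    represents the linear extension as an inner product.\<close>
  obtain T where T: "linear T" "\<And>v. v \<in> V \<Longrightarrow> T v = - l v"
    using linear_independent_extend[OF V(1), of "\<lambda>v. - l v"] by blast
  define a where "a = adjoint T 1"
  have Ta: "T x = a \<bullet> x" for x
    using adjoint_works[OF T(1), of x 1] by (simp add: a_def inner_commute)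
  have la: "l c = - (a \<bullet> c)" if "c \<in> C" for c
  proof -
    obtain b where b: "c = (\<Sum>v\<in>V. b v *\<^sub>R v)" "\<forall>v\<in>V. 0 \<le> b v"
      using \<open>c \<in> C\<close> unfolding CV by blast
    have "T c = (\<Sum>v\<in>V. b v * (- l v))"
      unfolding b(1) linear_sum[OF T(1)] by (intro sum.cong) (auto simp: linear_scale[OF T(1)] T(2))
    then show ?thesis
      using l_sum[OF finV order_refl, of b] b by (simp add: Ta sum_negf)
  qed
  have eq: "f (p + c) = f p * exp (- (a \<bullet> c))" if "c \<in> C" for c
  proof -
    have "f p * exp (l c) = f (p + c)"
      using fp fpos[OF that] by (simp add: l_def exp_diff)
    then show ?thesis
      by (simp add: la[OF that])
  qed
  have "0 \<le> a \<bullet> c" if c: "c \<in> C" for c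
  proof (rule ccontr)
    assume neg: "\<not> 0 \<le> a \<bullet> c"
    have "f p \<le> f (p + (2 ^ j) *\<^sub>R c)" for j :: nat
      using eq[OF scale[OF c, of "2 ^ j"]] neg fp by (simp add: mult_le_0_iff)
    then have "c = 0"
      using dyadic_ray_bounded_below_imp_zero[OF fp] by blast
    then show False using neg by simp
  qed
  with eq show thesis using that by blast
qed

end

section \<open>The integral inequality\<close>

lemma nn_integral_lborel_affine:
  fixes g :: "'a::euclidean_space \<Rightarrow> ennreal"
  assumes [measurable]: "g \<in> borel_measurable borel" and "c \<noteq> 0"
  shows "(\<integral>\<^sup>+ x. g x \<partial>lborel) = ennreal (\<bar>c\<bar> ^ DIM('a)) * (\<integral>\<^sup>+ x. g (t + c *\<^sub>R x) \<partial>lborel)"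
  by (subst lborel_affine[OF assms(2), of t])
    (simp add: nn_integral_density nn_integral_distr nn_integral_cmult)

lemma AE_lborel_open:
  fixes S :: "'a::euclidean_space set"
  assumes "AE x in lborel. P x" "open S" "S \<noteq> {}"
  shows "\<exists>x\<in>S. P x"
proof (rule ccontr)
  assume "\<not> (\<exists>x\<in>S. P x)"
  then have "AE x in lborel. x \<notin> S"
    using assms(1) by (auto elim: eventually_mono)
  then have "AE x in lebesgue. x \<notin> S"
    by (rule AE_completion)
  then have "S \<in> null_sets lebesgue"
    using assms(2) by (subst AE_iff_null_sets) auto
  then show False
    using open_not_negligible[OF assms(2,3)] by (simp add: negligible_iff_null_sets)
qed

lemma AE_lborel_not_frontier:
  fixes S :: "'a::euclidean_space set"
  assumes "convex S"
  shows "AE x in lborel. x \<notin> frontier S"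
proof -
  have "frontier S \<in> null_sets lebesgue"
    using negligible_convex_frontier[OF assms] by (simp add: negligible_iff_null_sets)
  then have "AE x in lebesgue. x \<notin> frontier S"
    by (rule AE_not_in)
  then show ?thesis
    by (simp add: AE_completion_iff)
qed

lemma isCont_off_frontier:
  fixes \<phi> :: "'a::euclidean_space \<Rightarrow> real"
  assumes "closed A" "continuous_on A \<phi>" "\<And>x. x \<notin> A \<Longrightarrow> \<phi> x = 0" "x \<notin> frontier A"
  shows "isCont \<phi> x"
proof (cases "x \<in> A")
  case True
  then have "x \<in> interior A"
    using assms(1,4) by (simp add: frontier_def)
  then show ?thesis
    using assms(2) continuous_on_interior by blast
next
  case False
  have "\<forall>\<^sub>F y in nhds x. \<phi> y = 0"
    using False assms by (intro eventually_nhds_in_open[of "- A", THEN eventually_mono]) auto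
  then show ?thesis
    using isCont_cong[of \<phi> "\<lambda>_. 0" x] by simp
qed

text \<open>Off both frontiers the difference is continuous, so it vanishes there. Positivity on the
  interiors then forces \<open>A = B\<close>, and the boundary values follow by continuity from
  inside.\<close>

lemma AE_eq_imp_eq_on_convex_supports:
  fixes \<phi> \<psi> :: "'a::euclidean_space \<Rightarrow> real"
  assumes A: "closed A" "convex A" "interior A \<noteq> {}" "continuous_on A \<phi>"
      "\<And>x. x \<notin> A \<Longrightarrow> \<phi> x = 0" "\<And>x. x \<in> interior A \<Longrightarrow> 0 < \<phi> x"
    and B: "closed B" "convex B" "interior B \<noteq> {}" "continuous_on B \<psi>"
      "\<And>x. x \<notin> B \<Longrightarrow> \<psi> x = 0" "\<And>x. x \<in> interior B \<Longrightarrow> 0 < \<psi> x"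
    and eq: "AE x in lborel. \<phi> x = \<psi> x"
  shows "\<phi> = \<psi>"
proof -
  have off: "\<phi> x = \<psi> x" if "x \<notin> frontier A" "x \<notin> frontier B" for x
  proof (rule ccontr)
    assume ne: "\<phi> x \<noteq> \<psi> x"
    have "isCont (\<lambda>y. \<phi> y - \<psi> y) x"
      using that A B by (intro continuous_intros isCont_off_frontier[of A] isCont_off_frontier[of B]) auto
    then obtain e where "0 < e" "\<And>y. dist x y < e \<Longrightarrow> \<phi> y - \<psi> y \<noteq> 0"
      using continuous_at_avoid[of x "\<lambda>y. \<phi> y - \<psi> y" 0] ne by auto
    then show False
      using AE_lborel_open[OF eq, of "ball x e"] by auto
  qed
  \<comment> \<open>A point of \<open>interior A\<close> outside the closed set \<open>B\<close>
    lies off both frontiers, with one function positive and the other zero. The sets and functions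
    are quantified so that the argument serves both inclusions.\<close>
  have sub: "A \<subseteq> B"
    if A: "closed A" "convex A" "interior A \<noteq> {}" "\<And>x. x \<in> interior A \<Longrightarrow> 0 < \<phi> x"
    and B: "closed B" "\<And>x. x \<notin> B \<Longrightarrow> \<psi> x = 0"
    and off: "\<And>x. x \<notin> frontier A \<Longrightarrow> x \<notin> frontier B \<Longrightarrow> \<phi> x = \<psi> x"
    for A B and \<phi> \<psi> :: "'a \<Rightarrow> real"
  proof -
    have "interior A \<subseteq> B"
    proof (rule ccontr)
      assume "\<not> interior A \<subseteq> B"
      then obtain x where x: "x \<in> interior A" "x \<notin> B" by blast
      then have "\<phi> x = \<psi> x"
        using B(1) by (intro off) (auto simp: frontier_def)
      then show False using A(4)[OF x(1)] B(2)[OF x(2)] by simp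
    qed
    then have "closure (interior A) \<subseteq> B"
      using B(1) by (rule closure_minimal)
    then show ?thesis
      using convex_closure_interior[OF A(2,3)] A(1) by simp
  qed
  have AB: "A = B"
    using sub[of A \<phi> B \<psi>] sub[of B \<psi> A \<phi>] A B off by (metis subset_antisym)
  show ?thesis
  proof
    fix x
    show "\<phi> x = \<psi> x"
    proof (cases "x \<in> A")
      case True
      have "\<phi> x - \<psi> x = 0"
      proof (rule continuous_constant_on_closure[of "interior A" "\<lambda>x. \<phi> x - \<psi> x" 0])
        show "continuous_on (closure (interior A)) (\<lambda>x. \<phi> x - \<psi> x)"
          using convex_closure_interior[OF A(2,3)] A B AB by (auto intro!: continuous_intros)
        show "x \<in> closure (interior A)"
          using True convex_closure_interior[OF A(2,3)] A(1) by simp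
        show "\<phi> y - \<psi> y = 0" if "y \<in> interior A" for y
          using off[of y] that AB by (auto simp: frontier_def)
      qed
      then show ?thesis by simp
    qed (use A(5) B(5) AB in auto)
  qed
qed

section \<open>Correlation, sup-convolution and the inequality between them\<close>

context log_concave_pair
begin

text \<open>For \<open>k x = g (- x)\<close>, \<open>corr\<close> is the convolution of
  \<open>f\<close> and \<open>g\<close>, and \<open>smax\<close> is
  \<open>lc_oplus f g\<close>.\<close>

definition "corr z = (\<integral>\<^sup>+ u. ennreal (f u * k (u - z)) \<partial>lborel)"
definition "smax z = (SUP x. sqrt (f x * k (x - 2 *\<^sub>R z)))"
definition "overlap = (\<integral>\<^sup>+ x. ennreal (sqrt (f x * k x)) \<partial>lborel)"

text \<open>The pairs \<open>(x, x - 2 z)\<close> and \<open>(w, w)\<close> have the midpoint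
  \<open>(u, u - z)\<close> with \<open>u = (x + w) / 2\<close>; midpoint concavity is applied to
  each function.\<close>

lemma pointwise:
  "sqrt (f x * k (x - 2 *\<^sub>R z)) * sqrt (f w * k w) \<le> f ((1/2) *\<^sub>R (x + w)) * k ((1/2) *\<^sub>R (x + w) - z)"
proof -
  have eq: "(1/2) *\<^sub>R (x + w) - z = (1/2) *\<^sub>R ((x - 2 *\<^sub>R z) + w)"
    by (simp add: algebra_simps)
  have "(f x * k (x - 2 *\<^sub>R z)) * (f w * k w) = (f x * f w) * (k (x - 2 *\<^sub>R z) * k w)"
    by simp
  also have "\<dots> \<le> (f ((1/2) *\<^sub>R (x + w)))\<^sup>2 * (k ((1/2) *\<^sub>R ((x - 2 *\<^sub>R z) + w)))\<^sup>2"
    by (intro mult_mono f.midpoint_le k.midpoint_le) (auto simp: f.nonneg k.nonneg)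
  finally have "sqrt ((f x * k (x - 2 *\<^sub>R z)) * (f w * k w)) \<le>
      f ((1/2) *\<^sub>R (x + w)) * k ((1/2) *\<^sub>R ((x - 2 *\<^sub>R z) + w))"
    by (intro real_le_lsqrt) (auto simp: f.nonneg k.nonneg power_mult_distrib)
  then show ?thesis
    by (simp add: real_sqrt_mult eq)
qed

text \<open>Substitution \<open>u = (x + w) / 2\<close>. The base point \<open>x\<close> is
  arbitrary, so it may later be a maximiser depending on \<open>z\<close>.\<close>

lemma corr_eq_midpoint:
  "2 ^ DIM('a) * corr z = (\<integral>\<^sup>+ w. ennreal (f ((1/2) *\<^sub>R (x + w)) * k ((1/2) *\<^sub>R (x + w) - z)) \<partial>lborel)"
proof -
  have "corr z = ennreal ((1/2) ^ DIM('a)) *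
      (\<integral>\<^sup>+ w. ennreal (f ((1/2) *\<^sub>R (x + w)) * k ((1/2) *\<^sub>R (x + w) - z)) \<partial>lborel)"
    unfolding corr_def
    by (subst nn_integral_lborel_affine[of _ "1/2" "(1/2) *\<^sub>R x"]) (simp_all add: scaleR_add_right)
  moreover have "(2 ^ DIM('a) :: ennreal) * ennreal ((1/2) ^ DIM('a)) = 1"
    using ennreal_power[of 2 "DIM('a)"] by (simp add: power_one_over flip: ennreal_mult')
  ultimately show ?thesis
    by (simp add: mult.assoc[symmetric])
qed

lemma maximizer: "\<exists>x. \<forall>y. f y * k (y - z) \<le> f x * k (x - z)"
proof (cases "\<exists>y. 0 < f y * k (y - z)")
  case True
  then obtain y0 where y0: "0 < f y0 * k (y0 - z)" by blast
  obtain B where B: "0 < B" "\<And>x. f x \<le> B" using f.bounded_above by blast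
  obtain B' where B': "0 < B'" "\<And>x. k x \<le> B'" using k.bounded_above by blast
  \<comment> \<open>Each factor is bounded, so a product at least as large as at \<open>y0\<close>
    bounds the other factor below; such points lie in the compact set \<open>T\<close>.\<close>
  define c where "c = f y0 * k (y0 - z) / B'"
  define c' where "c' = f y0 * k (y0 - z) / B"
  have c: "0 < c" "0 < c'" using y0 B B' by (auto simp: c_def c'_def)
  define T where "T = {x. c \<le> f x} \<inter> (+) z ` {x. c' \<le> k x}"
  have inT: "y \<in> T" if "f y0 * k (y0 - z) \<le> f y * k (y - z)" for y
  proof -
    have "f y * k (y - z) \<le> f y * B'" "f y * k (y - z) \<le> B * k (y - z)"
      using B B' f.nonneg k.nonneg by (auto intro: mult_left_mono mult_right_mono)
    then have "c \<le> f y" "c' \<le> k (y - z)"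
      using that B B' by (auto simp: c_def c'_def divide_le_eq mult.commute)
    then show ?thesis
      by (auto simp: T_def image_iff intro!: bexI[of _ "y - z"])
  qed
  have "compact T"
    unfolding T_def using c by (intro compact_Int f.compact_superlevel compact_translation k.compact_superlevel)
  moreover have "T \<noteq> {}"
    using inT[of y0] by auto
  moreover have "continuous_on T (\<lambda>x. f x * k (x - z))"
  proof (intro continuous_on_mult)
    show "continuous_on T f"
      using c f.in_support by (intro continuous_on_subset[OF f.cont]) (force simp: T_def)
    show "continuous_on T (\<lambda>x. k (x - z))"
      using c k.in_support
      by (intro continuous_on_compose2[OF k.cont] continuous_intros) (force simp: T_def)+
  qed
  ultimately obtain x where x: "x \<in> T" "\<And>y. y \<in> T \<Longrightarrow> f y * k (y - z) \<le> f x * k (x - z)"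
    using continuous_attains_sup[of T] by blast
  have "f y * k (y - z) \<le> f x * k (x - z)" for y
  proof (cases "y \<in> T")
    case False
    then have "f y * k (y - z) < f y0 * k (y0 - z)"
      using inT[of y] by force
    also have "\<dots> \<le> f x * k (x - z)"
      using x(2) inT[of y0] by auto
    finally show ?thesis by simp
  qed (use x in blast)
  then show ?thesis by blast
next
  case False
  have "0 \<le> f y * k (y - z)" for y
    by (simp add: f.nonneg k.nonneg)
  with False show ?thesis
    by (metis linorder_not_le order_antisym order_refl)
qed

lemma smax_eq:
  assumes "\<And>y. f y * k (y - 2 *\<^sub>R z) \<le> f x * k (x - 2 *\<^sub>R z)"
  shows "smax z = sqrt (f x * k (x - 2 *\<^sub>R z))"
  unfolding smax_def using assms by (intro cSup_eq_maximum) auto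

lemma smax_attained:
  obtains x where "\<And>y. f y * k (y - 2 *\<^sub>R z) \<le> f x * k (x - 2 *\<^sub>R z)"
    "smax z = sqrt (f x * k (x - 2 *\<^sub>R z))"
  using maximizer[of "2 *\<^sub>R z"] smax_eq by metis

lemma smax_nonneg: "0 \<le> smax z"
  by (rule smax_attained[of z]) (simp add: f.nonneg k.nonneg)

lemma smax_mult_overlap_le: "ennreal (smax z) * overlap \<le> 2 ^ DIM('a) * corr z"
proof -
  obtain x where x: "smax z = sqrt (f x * k (x - 2 *\<^sub>R z))"
    using smax_attained by metis
  have "ennreal (smax z) * overlap = (\<integral>\<^sup>+ w. ennreal (smax z * sqrt (f w * k w)) \<partial>lborel)"
    unfolding overlap_def
    by (subst nn_integral_cmult[symmetric]) (auto simp: ennreal_mult smax_nonneg f.nonneg k.nonneg)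
  also have "\<dots> \<le> 2 ^ DIM('a) * corr z"
    unfolding corr_eq_midpoint[of z x] x by (intro nn_integral_mono ennreal_leI pointwise)
  finally show ?thesis .
qed

lemma measurable_corr [measurable]: "corr \<in> borel_measurable borel"
proof -
  have "(\<lambda>z. \<integral>\<^sup>+ u. ennreal (f u * k (u - z)) \<partial>lborel) \<in> borel_measurable borel"
    by (rule lborel.borel_measurable_nn_integral) measurable
  then show ?thesis
    by (simp add: corr_def[abs_def])
qed

text \<open>The integral of a convolution: Tonelli, then invariance of the inner integral under
  reflection and translation.\<close>

lemma integral_corr:
  "(\<integral>\<^sup>+ z. corr z \<partial>lborel) = (\<integral>\<^sup>+ x. ennreal (f x) \<partial>lborel) * (\<integral>\<^sup>+ x. ennreal (k x) \<partial>lborel)"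
proof -
  have "(\<integral>\<^sup>+ z. corr z \<partial>lborel) = (\<integral>\<^sup>+ u. \<integral>\<^sup>+ z. ennreal (f u * k (u - z)) \<partial>lborel \<partial>lborel)"
    unfolding corr_def by (rule lborel_pair.Fubini') measurable
  also have "\<dots> = (\<integral>\<^sup>+ u. ennreal (f u) * (\<integral>\<^sup>+ x. ennreal (k x) \<partial>lborel) \<partial>lborel)"
  proof (intro nn_integral_cong)
    fix u
    have "(\<integral>\<^sup>+ x. ennreal (k x) \<partial>lborel) = (\<integral>\<^sup>+ z. ennreal (k (u - z)) \<partial>lborel)"
      by (subst nn_integral_lborel_affine[of _ "-1" u]) simp_all
    then show "(\<integral>\<^sup>+ z. ennreal (f u * k (u - z)) \<partial>lborel) = ennreal (f u) * (\<integral>\<^sup>+ x. ennreal (k x) \<partial>lborel)"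
      by (simp add: ennreal_mult f.nonneg k.nonneg nn_integral_cmult)
  qed
  also have "\<dots> = (\<integral>\<^sup>+ x. ennreal (f x) \<partial>lborel) * (\<integral>\<^sup>+ x. ennreal (k x) \<partial>lborel)"
    by (rule nn_integral_multc) measurable
  finally show ?thesis .
qed

lemma overlap_finite: "overlap < \<infinity>"
proof -
  have "sqrt (f x * k x) \<le> f x + k x" for x
    by (rule real_le_lsqrt) (auto simp: f.nonneg k.nonneg power2_eq_square algebra_simps)
  then have "overlap \<le> (\<integral>\<^sup>+ x. ennreal (f x) + ennreal (k x) \<partial>lborel)"
    unfolding overlap_def
    by (intro nn_integral_mono) (simp add: f.nonneg k.nonneg flip: ennreal_plus)
  also have "\<dots> < \<infinity>"
    using f.finite_integral k.finite_integral by (subst nn_integral_add) auto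
  finally show ?thesis .
qed

text \<open>Upper semicontinuity of \<open>smax\<close>. As \<open>k\<close> is bounded, the
  maximisers stay in a compact superlevel set of \<open>f\<close>; a convergent subsequence passes
  to the limit inside the closed supports.\<close>

lemma closed_smax_superlevel: assumes "0 < c" shows "closed {z. c \<le> smax z}"
  unfolding closed_sequential_limits
proof (intro allI impI, elim conjE)
  fix Z z assume Z: "\<forall>n. Z n \<in> {z. c \<le> smax z}" "Z \<longlonglongrightarrow> z"
  have "\<exists>x. c \<le> sqrt (f x * k (x - 2 *\<^sub>R Z n))" for n
    using Z(1) smax_attained[of "Z n"] by (metis mem_Collect_eq)
  then obtain X where X: "\<And>n. c \<le> sqrt (f (X n) * k (X n - 2 *\<^sub>R Z n))"
    by metis
  have pos: "0 < f (X n) * k (X n - 2 *\<^sub>R Z n)" for n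
    using X[of n] assms by (metis not_less order_trans real_sqrt_le_0_iff)
  then have fk: "0 < f (X n)" "0 < k (X n - 2 *\<^sub>R Z n)" for n
    using f.nonneg[of "X n"] k.nonneg[of "X n - 2 *\<^sub>R Z n"] pos[of n] by (auto simp: zero_less_mult_iff)
  obtain B where B: "0 < B" "\<And>x. k x \<le> B" using k.bounded_above by blast
  have "X n \<in> {x. c\<^sup>2 / B \<le> f x}" for n
  proof -
    have "c\<^sup>2 \<le> (sqrt (f (X n) * k (X n - 2 *\<^sub>R Z n)))\<^sup>2"
      using X[of n] assms by (intro power_mono) auto
    also have "\<dots> \<le> f (X n) * B"
      using pos[of n] B f.nonneg by (simp add: mult_left_mono)
    finally show ?thesis
      using B by (simp add: divide_le_eq)
  qed
  moreover have "seq_compact {x. c\<^sup>2 / B \<le> f x}"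
    using f.compact_superlevel[of "c\<^sup>2 / B"] assms B by (simp add: compact_eq_seq_compact_metric)
  ultimately obtain x r where r: "strict_mono r" "(X \<circ> r) \<longlonglongrightarrow> x"
    unfolding seq_compact_def by metis
  have Zr: "(Z \<circ> r) \<longlonglongrightarrow> z"
    using Z(2) r(1) by (rule LIMSEQ_subseq_LIMSEQ)
  have "(\<lambda>n. sqrt (f ((X \<circ> r) n) * k ((X \<circ> r) n - 2 *\<^sub>R (Z \<circ> r) n))) \<longlonglongrightarrow> sqrt (f x * k (x - 2 *\<^sub>R z))"
    using fk by (intro tendsto_intros f.tendsto_in_support k.tendsto_in_support r Zr)
      (auto intro: f.in_support k.in_support)
  then have "c \<le> sqrt (f x * k (x - 2 *\<^sub>R z))"
    by (rule LIMSEQ_le_const) (use X in auto)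
  also have "\<dots> \<le> smax z"
    by (rule smax_attained[of z]) simp
  finally show "z \<in> {z. c \<le> smax z}" by simp
qed

lemma measurable_smax [measurable]: "smax \<in> borel_measurable borel"
proof (rule borel_measurableI_ge)
  fix c
  show "{x \<in> space borel. c \<le> smax x} \<in> sets borel"
  proof (cases "0 < c")
    case False
    then have "{x \<in> space borel. c \<le> smax x} = UNIV"
      using order_trans[OF _ smax_nonneg, of c] by auto
    then show ?thesis by simp
  qed (use closed_smax_superlevel in auto)
qed

text \<open>Fatou: the integrands converge unless \<open>u - z\<close> lies on the frontier of the
  convex set \<open>L\<close>, which is null.\<close>

lemma corr_lower_semicontinuous:
  assumes "Z \<longlonglongrightarrow> z"
  shows "corr z \<le> liminf (\<lambda>n. corr (Z n))"
proof -
  have "AE u in lborel. u \<notin> frontier ((+) z ` L)"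
    by (intro AE_lborel_not_frontier convex_translation k.convex)
  then have "AE u in lborel. ennreal (f u * k (u - z)) = liminf (\<lambda>n. ennreal (f u * k (u - Z n)))"
  proof (rule eventually_mono)
    fix u assume "u \<notin> frontier ((+) z ` L)"
    then have "u - z \<notin> frontier L"
      by (auto simp: frontier_translation image_iff)
    then have "isCont k (u - z)"
      using isCont_off_frontier[OF k.closed k.cont k.zero] by blast
    then have "(\<lambda>n. k (u - Z n)) \<longlonglongrightarrow> k (u - z)"
      by (rule isCont_tendsto_compose) (intro tendsto_intros assms)
    then have "(\<lambda>n. ennreal (f u * k (u - Z n))) \<longlonglongrightarrow> ennreal (f u * k (u - z))"
      by (intro tendsto_intros tendsto_ennrealI)
    then show "ennreal (f u * k (u - z)) = liminf (\<lambda>n. ennreal (f u * k (u - Z n)))"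
      using lim_imp_Liminf trivial_limit_sequentially by metis
  qed
  then have "corr z = (\<integral>\<^sup>+ u. liminf (\<lambda>n. ennreal (f u * k (u - Z n))) \<partial>lborel)"
    unfolding corr_def by (rule nn_integral_cong_AE)
  also have "\<dots> \<le> liminf (\<lambda>n. corr (Z n))"
    unfolding corr_def by (rule nn_integral_liminf) measurable
  finally show ?thesis .
qed

text \<open>Equal finite integrals of ordered functions give equality for almost every
  \<open>z\<close>, hence on a dense set. Lower semicontinuity of \<open>corr\<close> and upper
  semicontinuity of \<open>smax\<close> transport the missing inequality to every
  \<open>z\<close>.\<close>

lemma equality_imp_pointwise_equality:
  assumes "(\<integral>\<^sup>+ z. ennreal (smax z) \<partial>lborel) * overlap =
    2 ^ DIM('a) * ((\<integral>\<^sup>+ x. ennreal (f x) \<partial>lborel) * (\<integral>\<^sup>+ x. ennreal (k x) \<partial>lborel))"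
  shows "ennreal (smax z) * overlap = 2 ^ DIM('a) * corr z"
proof (rule antisym[OF smax_mult_overlap_le])
  have int: "(\<integral>\<^sup>+ z. ennreal (smax z) * overlap \<partial>lborel) = (\<integral>\<^sup>+ z. 2 ^ DIM('a) * corr z \<partial>lborel)"
    using assms by (simp add: nn_integral_multc nn_integral_cmult integral_corr)
  have "(\<integral>\<^sup>+ z. 2 ^ DIM('a) * corr z \<partial>lborel) < \<infinity>"
    using f.finite_integral k.finite_integral
    by (simp add: nn_integral_cmult integral_corr ennreal_mult_less_top power_less_top_ennreal)
  then have "AE z in lborel. 2 ^ DIM('a) * corr z \<le> ennreal (smax z) * overlap"
    using nn_integral_less[of "\<lambda>z. ennreal (smax z) * overlap" lborel "\<lambda>z. 2 ^ DIM('a) * corr z"]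
      smax_mult_overlap_le int by fastforce
  then have "\<exists>y\<in>ball z (1 / Suc n). 2 ^ DIM('a) * corr y \<le> ennreal (smax y) * overlap" for n
    by (rule AE_lborel_open) auto
  then obtain Z where Z: "\<And>n. dist z (Z n) < 1 / Suc n"
    "\<And>n. 2 ^ DIM('a) * corr (Z n) \<le> ennreal (smax (Z n)) * overlap"
    by (simp only: mem_ball Bex_def) metis
  have Zz: "Z \<longlonglongrightarrow> z"
  proof (rule metric_LIMSEQ_I)
    fix r :: real assume "0 < r"
    then obtain N where N: "1 / Suc N < r"
      using nat_approx_posE by blast
    have "dist (Z n) z < r" if "n \<ge> N" for n
    proof -
      have "1 / real (Suc n) \<le> 1 / real (Suc N)"
        using that by (intro divide_left_mono) auto
      then show ?thesis
        using Z(1)[of n] N by (simp add: dist_commute)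
    qed
    then show "\<exists>no. \<forall>n\<ge>no. dist (Z n) z < r" by blast
  qed
  obtain r where r: "overlap = ennreal r" "0 \<le> r"
    using overlap_finite by (cases overlap) auto
  \<comment> \<open>For \<open>c\<close> strictly above \<open>smax z\<close> the set where
    \<open>smax < c\<close> is open and eventually contains \<open>Z n\<close>; at the end
    \<open>c\<close> decreases to \<open>smax z\<close>.\<close>
  have bound: "2 ^ DIM('a) * corr z \<le> ennreal (c * r)" if "smax z < c" for c
  proof -
    have "0 < c" using that smax_nonneg[of z] by simp
    have "\<forall>\<^sub>F n in sequentially. Z n \<in> - {z. c \<le> smax z}"
      using Zz closed_smax_superlevel[OF \<open>0 < c\<close>] that by (intro topological_tendstoD) auto
    then have ev: "\<forall>\<^sub>F n in sequentially. 2 ^ DIM('a) * corr (Z n) \<le> ennreal (c * r)"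
    proof (rule eventually_mono)
      fix n assume "Z n \<in> - {z. c \<le> smax z}"
      then have "ennreal (smax (Z n)) * overlap \<le> ennreal (c * r)"
        using r smax_nonneg by (auto simp flip: ennreal_mult intro!: ennreal_leI mult_right_mono)
      then show "2 ^ DIM('a) * corr (Z n) \<le> ennreal (c * r)"
        using Z(2)[of n] by simp
    qed
    have "2 ^ DIM('a) * corr z \<le> 2 ^ DIM('a) * liminf (\<lambda>n. corr (Z n))"
      by (intro mult_left_mono corr_lower_semicontinuous Zz) simp
    also have "\<dots> = liminf (\<lambda>n. 2 ^ DIM('a) * corr (Z n))"
      by (rule Liminf_compose_continuous_mono[symmetric])
        (auto intro!: ennreal_tendsto_cmult tendsto_ident_at monoI mult_left_mono
          simp: continuous_on_def power_less_top_ennreal)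
    also have "\<dots> \<le> liminf (\<lambda>n. ennreal (c * r))"
      using ev by (rule Liminf_mono)
    finally show ?thesis by (simp add: Liminf_const)
  qed
  have "(\<lambda>n. ennreal ((smax z + 1 / Suc n) * r)) \<longlonglongrightarrow> ennreal ((smax z + 0) * r)"
    by (intro tendsto_ennrealI tendsto_intros LIMSEQ_Suc[OF lim_1_over_n])
  then have "2 ^ DIM('a) * corr z \<le> ennreal ((smax z + 0) * r)"
    by (rule LIMSEQ_le_const) (auto intro!: bound)
  then show "2 ^ DIM('a) * corr z \<le> ennreal (smax z) * overlap"
    using r smax_nonneg by (simp add: ennreal_mult)
qed

end

section \<open>Decay of integrable log-concave functions\<close>

text \<open>A convex set containing a ball and a very distant point contains arbitrarily many
  disjoint balls of half the radius, contradicting finite measure.\<close>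

lemma convex_finite_measure_imp_bounded:
  fixes S :: "'a::euclidean_space set"
  assumes "convex S" "interior S \<noteq> {}" "S \<in> sets lborel" "emeasure lborel S < \<infinity>"
  shows "bounded S"
proof (rule ccontr)
  assume unb: "\<not> bounded S"
  obtain x0 r where r: "0 < r" "ball x0 r \<subseteq> S"
    using assms(2) by (meson all_not_in_conv mem_interior)
  define v where "v = unit_ball_vol (real DIM('a)) * (r/2) ^ DIM('a)"
  have v: "0 < v" using r by (simp add: v_def)
  obtain m where m: "emeasure lborel S = ennreal m" "0 \<le> m"
    using assms(4) by (cases "emeasure lborel S") auto
  obtain N :: nat where N: "m / v < N"
    using reals_Archimedean2 by blast
  have "0 \<le> m / v"
    using m(2) v by simp
  then have N0: "0 < N"
    using N by linarith
  obtain y where y: "y \<in> S" "2 * N * r < norm (y - x0)"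
  proof -
    have "\<not> S \<subseteq> cball x0 (2 * N * r)"
      using unb bounded_cball bounded_subset by blast
    then show thesis
      using that by (auto simp: dist_norm norm_minus_commute not_le subset_iff)
  qed
  \<comment> \<open>The denominator \<open>2 * N\<close> keeps the parameters at most
    \<open>1/2\<close>, so balls contracted towards \<open>y\<close> still have radius at least
    \<open>r / 2\<close>; the distance of \<open>y\<close> separates consecutive centres by more
    than \<open>r\<close>.\<close>
  define c where "c i = x0 + (real i / (2 * N)) *\<^sub>R (y - x0)" for i
  have sub: "ball (c i) (r/2) \<subseteq> S" if "i < N" for i
  proof
    fix w assume w: "w \<in> ball (c i) (r/2)"
    define t where "t = real i / (2 * N)"
    have t: "0 \<le> t" "t \<le> 1/2" "0 < 1 - t" using that N0 by (auto simp: t_def field_simps)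
    \<comment> \<open>Chosen so that \<open>w = (1 - t) b + t y\<close>; the factor
      \<open>1 / (1 - t) \<le> 2\<close> keeps \<open>b\<close> within \<open>r\<close> of
      \<open>x0\<close>.\<close>
    define b where "b = x0 + (1 / (1 - t)) *\<^sub>R (w - c i)"
    have "norm (w - c i) < r / 2"
      using w by (simp add: dist_norm norm_minus_commute)
    also have "\<dots> \<le> r * (1 - t)"
      using t r by (simp add: field_simps)
    finally have "b \<in> ball x0 r"
      using t by (simp add: b_def dist_norm divide_less_eq)
    then have "(1 - t) *\<^sub>R b + t *\<^sub>R y \<in> S"
      using r t y by (intro convexD[OF assms(1)]) auto
    moreover have "(1 - t) *\<^sub>R b + t *\<^sub>R y = w"
    proof -
      have "(1 - t) *\<^sub>R b = (1 - t) *\<^sub>R x0 + (w - c i)"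
        using t by (simp add: b_def scaleR_add_right)
      moreover have "c i = x0 + t *\<^sub>R (y - x0)"
        by (simp add: c_def t_def)
      ultimately show ?thesis
        by (simp add: algebra_simps)
    qed
    ultimately show "w \<in> S" by simp
  qed
  have disj: "disjoint_family_on (\<lambda>i. ball (c i) (r/2)) {..<N}"
  proof (clarsimp simp: disjoint_family_on_def)
    fix i j :: nat assume ij: "i \<noteq> j"
    have "c i - c j = ((real i - real j) / (2 * N)) *\<^sub>R (y - x0)"
      by (simp add: c_def diff_divide_distrib scaleR_diff_left)
    then have "dist (c i) (c j) = \<bar>real i - real j\<bar> * (norm (y - x0) / (2 * N))"
      using N0 by (simp add: dist_norm)
    also have "\<dots> \<ge> 1 * r"
      using ij y N0 r by (intro mult_mono) (auto simp: field_simps)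
    finally have "r \<le> dist (c i) (c j)" by simp
    then show "ball (c i) (r/2) \<inter> ball (c j) (r/2) = {}"
      by (intro disjoint_ballI) simp
  qed
  have "ennreal (N * v) = (\<Sum>i<N. emeasure lborel (ball (c i) (r/2)))"
    using r v by (simp add: emeasure_ball v_def[symmetric] ennreal_mult ennreal_of_nat_eq_real_of_nat)
  also have "\<dots> = emeasure lborel (\<Union>i<N. ball (c i) (r/2))"
    using disj by (intro sum_emeasure) auto
  also have "\<dots> \<le> ennreal m"
    unfolding m(1)[symmetric] using sub assms(3) by (intro emeasure_mono) auto
  finally show False
    using N m v by (simp add: field_simps)
qed

section \<open>Positivity, concavity and superlevel sets of log-concave functions\<close>

lemma log_concave_nonneg: assumes "log_concave f" shows "0 \<le> f x"
proof -
  obtain D u where "f x = (if x \<in> D then exp (- u x) else 0)"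
    using assms unfolding log_concave_def by blast
  then show ?thesis by simp
qed

lemma log_concave_convex_positive: assumes "log_concave f" shows "convex {x. f x \<noteq> 0}"
proof -
  obtain D u where D: "convex D" "\<And>x. f x = (if x \<in> D then exp (- u x) else 0)"
    using assms unfolding log_concave_def by blast
  then have "{x. f x \<noteq> 0} = D"
    by simp
  then show ?thesis
    using D(1) by simp
qed

lemma log_concave_powr:
  assumes "log_concave f" "0 \<le> t" "t \<le> 1"
  shows "f x powr (1 - t) * f y powr t \<le> f ((1 - t) *\<^sub>R x + t *\<^sub>R y)"
proof -
  obtain D u where D: "convex D" "convex_on D u" "\<And>x. f x = (if x \<in> D then exp (- u x) else 0)"
    using assms(1) unfolding log_concave_def by blast
  show ?thesis
  proof (cases "x \<in> D \<and> y \<in> D")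
    case True
    then have "(1 - t) *\<^sub>R x + t *\<^sub>R y \<in> D"
      using assms by (intro convexD[OF D(1)]) auto
    moreover have "u ((1 - t) *\<^sub>R x + t *\<^sub>R y) \<le> (1 - t) * u x + t * u y"
      using True assms D(2) by (intro convex_onD) auto
    moreover have "exp (- u x) powr (1 - t) * exp (- u y) powr t = exp (- ((1 - t) * u x + t * u y))"
      by (simp add: powr_def exp_add[symmetric] algebra_simps)
    ultimately show ?thesis
      using True D(3) by simp
  next
    case False
    then have "f x = 0 \<or> f y = 0"
      using D(3)[of x] D(3)[of y] by argo
    then show ?thesis
      using log_concave_nonneg[OF assms(1)] by auto
  qed
qed

lemma log_concave_convex_superlevel:
  assumes "log_concave f" "0 < c"
  shows "convex {x. c \<le> f x}"
proof (rule convexI, clarify)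
  fix x y and s t :: real
  assume xy: "c \<le> f x" "c \<le> f y" and st: "0 \<le> s" "0 \<le> t" "s + t = 1"
  have s: "s = 1 - t" using st by simp
  have "c = c powr (1 - t) * c powr t"
    using assms(2) by (simp flip: powr_add)
  also have "\<dots> \<le> f x powr (1 - t) * f y powr t"
    using xy st assms(2) by (intro mult_mono powr_mono2) auto
  also have "\<dots> \<le> f (s *\<^sub>R x + t *\<^sub>R y)"
    unfolding s using st by (intro log_concave_powr assms(1)) auto
  finally show "c \<le> f (s *\<^sub>R x + t *\<^sub>R y)" .
qed

text \<open>A convex set and its closure have the same interior, so passing to the support adds no
  interior zeros.\<close>

lemma log_concave_pos_interior_supp:
  assumes "log_concave f" "x \<in> interior (supp f)"
  shows "0 < f x"
proof -
  have "x \<in> interior {x. f x \<noteq> 0}"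
    using assms(2) convex_interior_closure[OF log_concave_convex_positive[OF assms(1)]]
    by (simp add: supp_def)
  then have "f x \<noteq> 0"
    using interior_subset by blast
  then show ?thesis
    using log_concave_nonneg[OF assms(1), of x] by simp
qed

lemma supp_zero: "x \<notin> supp f \<Longrightarrow> f x = 0"
  unfolding supp_def using closure_subset[of "{x. f x \<noteq> 0}"] by blast

text \<open>Superlevel sets are convex and, by Markov's inequality, of finite measure; what remains
  is to provide interior points.\<close>

lemma log_concave_bounded_superlevel:
  fixes f :: "'a::euclidean_space \<Rightarrow> real"
  assumes f: "log_concave f" "integrable lborel f" "interior (supp f) \<noteq> {}" "continuous_on (supp f) f"
    and c: "0 < c"
  shows "bounded {x. c \<le> f x}"
proof -
  have [measurable]: "f \<in> borel_measurable borel"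
    using f(2) by auto
  obtain x0 where x0: "x0 \<in> interior (supp f)"
    using f(3) by blast
  \<comment> \<open>The set at level \<open>c\<close> may have empty interior or be empty; a level
    below \<open>f x0\<close> contains a neighbourhood of \<open>x0\<close>.\<close>
  define d where "d = min c (f x0 / 2)"
  have fx0: "0 < f x0" using log_concave_pos_interior_supp[OF f(1) x0] .
  have d: "0 < d" "d < f x0" using c fx0 by (auto simp: d_def)
  have "bounded {x. d \<le> f x}"
  proof (rule convex_finite_measure_imp_bounded)
    show "convex {x. d \<le> f x}"
      by (rule log_concave_convex_superlevel[OF f(1) d(1)])
    have "isCont f x0"
      using f(4) x0 continuous_on_interior by blast
    then have "\<forall>\<^sub>F x in nhds x0. d < f x"
      using d(2) by (intro order_tendstoD) (simp add: isCont_def tendsto_at_iff_tendsto_nhds)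
    then obtain S where "open S" "x0 \<in> S" "\<And>x. x \<in> S \<Longrightarrow> d < f x"
      by (auto simp: eventually_nhds)
    then have "S \<subseteq> interior {x. d \<le> f x}"
      by (intro interior_maximal) force+
    then show "interior {x. d \<le> f x} \<noteq> {}"
      using \<open>x0 \<in> S\<close> by blast
    show "{x. d \<le> f x} \<in> sets lborel"
      by measurable
    have "ennreal d * emeasure lborel {x. d \<le> f x} = (\<integral>\<^sup>+ x. ennreal d * indicator {x. d \<le> f x} x \<partial>lborel)"
      by (subst nn_integral_cmult_indicator) auto
    also have "\<dots> \<le> (\<integral>\<^sup>+ x. ennreal (f x) \<partial>lborel)"
      by (intro nn_integral_mono) (auto simp: indicator_def intro!: ennreal_leI)
    also have "\<dots> < \<infinity>"
      using f(2) log_concave_nonneg[OF f(1)] by (simp add: nn_integral_eq_integral)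
    finally show "emeasure lborel {x. d \<le> f x} < \<infinity>"
      using d(1) by (auto simp: ennreal_mult_less_top)
  qed
  then show ?thesis
    by (rule bounded_subset) (auto simp: d_def)
qed

lemma log_concave_decaying:
  fixes f :: "'a::euclidean_space \<Rightarrow> real"
  assumes "log_concave f" "integrable lborel f" "interior (supp f) \<noteq> {}" "continuous_on (supp f) f"
  shows "decaying_log_concave f (supp f)"
proof
  show "convex (supp f)"
    unfolding supp_def by (intro convex_closure log_concave_convex_positive assms)
  show "f x powr (1 - t) * f y powr t \<le> f ((1 - t) *\<^sub>R x + t *\<^sub>R y)"
    if "0 \<le> t" "t \<le> 1" for x y t
    using log_concave_powr[OF assms(1) that] .
  show "(\<integral>\<^sup>+ x. ennreal (f x) \<partial>lborel) < \<infinity>"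
    using assms(2) log_concave_nonneg[OF assms(1)] by (simp add: nn_integral_eq_integral)
  show "f \<in> borel_measurable borel"
    using assms(2) by auto
  show "bounded {x. c \<le> f x}" if "0 < c" for c
    using log_concave_bounded_superlevel[OF assms that] .
  show "closed (supp f)"
    by (simp add: supp_def)
qed (use assms in \<open>simp_all add: log_concave_nonneg log_concave_pos_interior_supp supp_zero\<close>)

section \<open>Reflection preserves the standing assumptions\<close>

lemma log_concave_refl_fun: assumes "log_concave g" shows "log_concave (refl_fun g)"
proof -
  obtain D u where D: "convex D" "convex_on D u" "\<And>x. g x = (if x \<in> D then exp (- u x) else 0)"
    using assms unfolding log_concave_def by blast
  have "convex (uminus ` D)"
    by (rule convex_negations[OF D(1)])
  moreover have "convex_on (uminus ` D) (\<lambda>x. u (- x))"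
  proof (rule convex_onI)
    fix t :: real and x y
    assume "0 < t" "t < 1" "x \<in> uminus ` D" "y \<in> uminus ` D"
    then have "u ((1 - t) *\<^sub>R (- x) + t *\<^sub>R (- y)) \<le> (1 - t) * u (- x) + t * u (- y)"
      by (intro convex_onD[OF D(2)]) auto
    then show "u (- ((1 - t) *\<^sub>R x + t *\<^sub>R y)) \<le> (1 - t) * u (- x) + t * u (- y)"
      by simp
  qed fact
  moreover have "refl_fun g x = (if x \<in> uminus ` D then exp (- u (- x)) else 0)" for x
  proof -
    have "- x \<in> D \<longleftrightarrow> x \<in> uminus ` D"
      by force
    then show ?thesis
      using D(3)[of "- x"] by (simp add: refl_fun_def)
  qed
  ultimately show ?thesis
    unfolding log_concave_def by blast
qed

lemma supp_refl_fun:
  fixes g :: "'a::euclidean_space \<Rightarrow> real"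
  shows "supp (refl_fun g) = uminus ` supp g"
proof -
  have "{x. refl_fun g x \<noteq> 0} = uminus ` {x. g x \<noteq> 0}"
    by (force simp: refl_fun_def)
  then show ?thesis
    using closure_injective_linear_image[of uminus "{x. g x \<noteq> 0}"]
    by (simp add: supp_def linear_uminus)
qed

lemma refl_fun_decaying:
  fixes g :: "'a::euclidean_space \<Rightarrow> real"
  assumes "log_concave g" "integrable lborel g" "interior (supp g) \<noteq> {}" "continuous_on (supp g) g"
  shows "decaying_log_concave (refl_fun g) (supp (refl_fun g))"
proof (rule log_concave_decaying[OF log_concave_refl_fun[OF assms(1)]])
  show "integrable lborel (refl_fun g)"
  proof (rule integrableI_nonneg)
    have [measurable]: "g \<in> borel_measurable borel"
      using assms(2) by auto
    show "refl_fun g \<in> borel_measurable lborel"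
      unfolding refl_fun_def by measurable
    show "AE x in lborel. 0 \<le> refl_fun g x"
      using log_concave_nonneg[OF assms(1)] by (simp add: refl_fun_def)
    have "(\<integral>\<^sup>+ x. ennreal (refl_fun g x) \<partial>lborel) = (\<integral>\<^sup>+ x. ennreal (g x) \<partial>lborel)"
      by (subst nn_integral_lborel_affine[of _ "-1" 0]) (simp_all add: refl_fun_def)
    also have "\<dots> < \<infinity>"
      using assms(2) log_concave_nonneg[OF assms(1)] by (simp add: nn_integral_eq_integral)
    finally show "(\<integral>\<^sup>+ x. ennreal (refl_fun g x) \<partial>lborel) < \<infinity>" .
  qed
  show "interior (supp (refl_fun g)) \<noteq> {}"
    using assms(3) by (simp add: supp_refl_fun interior_negations)
  show "continuous_on (supp (refl_fun g)) (refl_fun g)"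
    unfolding supp_refl_fun refl_fun_def
    by (intro continuous_on_compose2[OF assms(4)] continuous_intros) auto
qed

section \<open>The equality case\<close>

context log_concave_pair
begin

text \<open>A closed convex set without interior is its own frontier, hence null, and the overlap
  would vanish.\<close>

lemma interior_Int_if_overlap: assumes "overlap \<noteq> 0" shows "interior (K \<inter> L) \<noteq> {}"
proof
  assume "interior (K \<inter> L) = {}"
  moreover have "closed (K \<inter> L)"
    using f.closed k.closed by blast
  ultimately have "frontier (K \<inter> L) = K \<inter> L"
    by (simp add: frontier_def)
  then have "AE x in lborel. x \<notin> K \<inter> L"
    using AE_lborel_not_frontier[OF convex_Int[OF f.convex k.convex]] by simp
  then have "AE x in lborel. ennreal (sqrt (f x * k x)) = 0"
    by (rule eventually_mono) (use f.zero k.zero in auto)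
  then show False
    using assms by (simp add: overlap_def nn_integral_0_iff_AE)
qed

text \<open>For a maximiser \<open>x\<close>, integrating \<open>pointwise\<close> over
  \<open>w\<close> loses nothing, so it is an equality for almost all \<open>w\<close>, hence for
  all. The claim is the case \<open>w = 2 u - x\<close>.\<close>

lemma pointwise_equality:
  assumes "interior (K \<inter> L) \<noteq> {}"
    and eq: "ennreal (smax z) * overlap = 2 ^ DIM('a) * corr z"
    and x: "smax z = sqrt (f x * k (x - 2 *\<^sub>R z))" "0 < f x * k (x - 2 *\<^sub>R z)"
  shows "f u * k (u - z) = sqrt (f x * k (x - 2 *\<^sub>R z)) * sqrt (f (2 *\<^sub>R u - x) * k (2 *\<^sub>R u - x))"
proof -
  define m where "m w = (1/2) *\<^sub>R (x + w)" for w
  define \<phi> where "\<phi> w = f (m w) * k (m w - z)" for w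
  define \<psi> where "\<psi> w = smax z * sqrt (f w * k w)" for w
  \<comment> \<open>The preimage of \<open>K \<inter> (z + L)\<close> under the affine map
    \<open>m\<close>, whereas \<open>\<psi>\<close> lives on \<open>K \<inter> L\<close>; the
    comparison lemma allows the two supports to differ beforehand.\<close>
  define A where "A = {w. m w \<in> K \<and> m w - z \<in> L}"
  have xK: "x \<in> K" "x - 2 *\<^sub>R z \<in> L"
    using x(2) f.zero k.zero by (metis less_irrefl mult_zero_left, metis less_irrefl mult_zero_right)
  have s: "0 < smax z" using x by simp
  have [continuous_intros]: "continuous_on S m" for S
    unfolding m_def by (intro continuous_intros)
  have [measurable]: "m \<in> borel_measurable borel"
    unfolding m_def by measurable
  have mz: "m w - z = (1/2) *\<^sub>R ((x - 2 *\<^sub>R z) + w)" for w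
    by (simp add: m_def algebra_simps)
  have mc: "m ((1 - t) *\<^sub>R v + t *\<^sub>R w) = (1 - t) *\<^sub>R m v + t *\<^sub>R m w" for v w t
  proof -
    have "(1 - t) *\<^sub>R m v + t *\<^sub>R m w =
        (1/2) *\<^sub>R (((1 - t) *\<^sub>R x + t *\<^sub>R x) + ((1 - t) *\<^sub>R v + t *\<^sub>R w))"
      by (simp add: m_def scaleR_add_right) (simp flip: scaleR_add_left add_divide_distrib)
    also have "(1 - t) *\<^sub>R x + t *\<^sub>R x = x"
      by (simp flip: scaleR_add_left)
    finally show ?thesis
      by (simp add: m_def)
  qed
  have sub: "K \<inter> L \<subseteq> A"
  proof
    fix w assume "w \<in> K \<inter> L"
    then show "w \<in> A"
      using xK convexD[OF f.convex, of x w "1/2" "1/2"] convexD[OF k.convex, of "x - 2 *\<^sub>R z" w "1/2" "1/2"]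
      unfolding A_def mz by (simp add: m_def scaleR_add_right)
  qed
  have "\<phi> = \<psi>"
  proof (rule AE_eq_imp_eq_on_convex_supports[of A \<phi> "K \<inter> L" \<psi>])
    show "closed A"
      unfolding A_def using f.closed k.closed
      by (intro closed_Collect_conj closed_vimage[unfolded vimage_def, of K m]
          closed_vimage[unfolded vimage_def, of L "\<lambda>w. m w - z"] continuous_intros) auto
    show "convex A"
    proof (rule convexI)
      fix v w and s t :: real
      assume vw: "v \<in> A" "w \<in> A" and st: "0 \<le> s" "0 \<le> t" "s + t = 1"
      have s: "s = 1 - t" using st by simp
      have "m (s *\<^sub>R v + t *\<^sub>R w) - z = s *\<^sub>R (m v - z) + t *\<^sub>R (m w - z)"
        unfolding s mc by (simp add: algebra_simps)
      moreover have "m (s *\<^sub>R v + t *\<^sub>R w) = s *\<^sub>R m v + t *\<^sub>R m w"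
        unfolding s mc ..
      ultimately show "s *\<^sub>R v + t *\<^sub>R w \<in> A"
        using vw st by (simp add: A_def convexD[OF f.convex] convexD[OF k.convex])
    qed
    show "interior A \<noteq> {}"
      using assms(1) interior_mono[OF sub] by blast
    show "continuous_on A \<phi>"
      unfolding \<phi>_def
      by (intro continuous_on_mult continuous_on_compose2[OF f.cont] continuous_on_compose2[OF k.cont]
          continuous_intros) (auto simp: A_def)
    show "\<phi> w = 0" if "w \<notin> A" for w
      using that f.zero k.zero by (auto simp: A_def \<phi>_def)
    show "0 < \<phi> w" if w: "w \<in> interior A" for w
    proof -
      obtain e where e: "0 < e" "ball w e \<subseteq> A"
        using w by (auto simp: mem_interior)
      \<comment> \<open>\<open>m\<close> halves distances and \<open>2 y - x\<close> is the preimage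
        of \<open>y\<close>, so a ball of radius \<open>e\<close> in \<open>A\<close> yields one of
        radius \<open>e / 2\<close> about \<open>m w\<close>.\<close>
      have mA: "2 *\<^sub>R y - x \<in> A" if "dist (m w) y < e / 2" for y
      proof -
        have "w - (2 *\<^sub>R y - x) = 2 *\<^sub>R (m w - y)"
          by (simp add: m_def algebra_simps)
        then have "dist w (2 *\<^sub>R y - x) = 2 * dist (m w) y"
          by (simp add: dist_norm)
        then show ?thesis
          using that e by auto
      qed
      have m2: "m (2 *\<^sub>R y - x) = y" for y
        by (simp add: m_def)
      have "m w \<in> interior K"
        unfolding mem_interior using e(1) mA m2 by (intro exI[of _ "e/2"]) (auto simp: A_def)
      moreover have "m w - z \<in> interior L"
      proof -
        have "y \<in> L" if "dist (m w - z) y < e/2" for y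
        proof -
          have "dist (m w) (y + z) < e/2"
            using that by (simp add: dist_norm algebra_simps)
          then show ?thesis
            using mA[of "y + z"] m2[of "y + z"] by (simp add: A_def)
        qed
        then show ?thesis
          unfolding mem_interior using e(1) by (intro exI[of _ "e/2"]) auto
      qed
      ultimately show ?thesis
        by (simp add: \<phi>_def f.pos k.pos)
    qed
    show "closed (K \<inter> L)" "convex (K \<inter> L)" "interior (K \<inter> L) \<noteq> {}"
      using assms(1) f.closed k.closed f.convex k.convex by (auto intro: convex_Int)
    show "continuous_on (K \<inter> L) \<psi>"
      unfolding \<psi>_def
      by (intro continuous_intros continuous_on_subset[OF f.cont] continuous_on_subset[OF k.cont]) auto
    show "\<psi> w = 0" if "w \<notin> K \<inter> L" for w
      using that f.zero k.zero by (auto simp: \<psi>_def)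
    show "0 < \<psi> w" if "w \<in> interior (K \<inter> L)" for w
      using that s f.pos k.pos by (simp add: \<psi>_def)
    have le: "\<psi> w \<le> \<phi> w" for w
      using pointwise[of x z w] x by (simp add: \<psi>_def \<phi>_def m_def)
    have \<psi>_int: "(\<integral>\<^sup>+ w. ennreal (\<psi> w) \<partial>lborel) = ennreal (smax z) * overlap"
      unfolding overlap_def \<psi>_def
      by (subst nn_integral_cmult[symmetric]) (auto simp: ennreal_mult smax_nonneg f.nonneg k.nonneg)
    have "(\<integral>\<^sup>+ w. ennreal (\<phi> w) \<partial>lborel) = 2 ^ DIM('a) * corr z"
      unfolding corr_eq_midpoint[of z x] \<phi>_def m_def ..
    then have int: "(\<integral>\<^sup>+ w. ennreal (\<psi> w) \<partial>lborel) = (\<integral>\<^sup>+ w. ennreal (\<phi> w) \<partial>lborel)"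
      "(\<integral>\<^sup>+ w. ennreal (\<psi> w) \<partial>lborel) \<noteq> \<infinity>"
      using \<psi>_int eq overlap_finite ennreal_mult_less_top[of "ennreal (smax z)" overlap] by auto
    have meas: "(\<lambda>w. ennreal (\<psi> w)) \<in> borel_measurable lborel" "(\<lambda>w. ennreal (\<phi> w)) \<in> borel_measurable lborel"
      unfolding \<psi>_def \<phi>_def by measurable
    have "AE w in lborel. ennreal (\<phi> w) \<le> ennreal (\<psi> w)"
    proof (rule ccontr)
      assume "\<not> ?thesis"
      then have "(\<integral>\<^sup>+ w. ennreal (\<psi> w) \<partial>lborel) < (\<integral>\<^sup>+ w. ennreal (\<phi> w) \<partial>lborel)"
        using le int(2) by (intro nn_integral_less meas) (auto intro: ennreal_leI)
      then show False using int(1) by simp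
    qed
    then show "AE w in lborel. \<phi> w = \<psi> w"
    proof (rule eventually_mono)
      fix w assume "ennreal (\<phi> w) \<le> ennreal (\<psi> w)"
      moreover have "0 \<le> \<psi> w"
        by (simp add: \<psi>_def smax_nonneg f.nonneg k.nonneg)
      ultimately show "\<phi> w = \<psi> w"
        using le[of w] by (simp add: ennreal_le_iff)
    qed
  qed
  then have "\<phi> (2 *\<^sub>R u - x) = \<psi> (2 *\<^sub>R u - x)"
    by simp
  then show ?thesis
    by (simp add: \<phi>_def \<psi>_def m_def x(1))
qed

text \<open>The peak \<open>p\<close> is the maximiser for \<open>z = 0\<close>; an interior point
  of \<open>K \<inter> L\<close> ensures that the maximum is positive.\<close>

lemma equality_imp_rigid:
  assumes eq: "\<And>z. ennreal (smax z) * overlap = 2 ^ DIM('a) * corr z" and "overlap \<noteq> 0"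
  shows "\<exists>p. rigid_pair f k K L p"
proof -
  have int: "interior (K \<inter> L) \<noteq> {}"
    using interior_Int_if_overlap assms(2) .
  have rigid: "\<exists>x. (\<forall>y. f y * k (y - 2 *\<^sub>R z) \<le> f x * k (x - 2 *\<^sub>R z)) \<and>
        0 < f x * k (x - 2 *\<^sub>R z) \<and>
        (\<forall>u. (f u * k (u - z))\<^sup>2 =
              (f x * k (x - 2 *\<^sub>R z)) * (f (2 *\<^sub>R u - x) * k (2 *\<^sub>R u - x)))"
    if "0 < f y * k (y - 2 *\<^sub>R z)" for y z
  proof -
    obtain x where x: "\<And>y. f y * k (y - 2 *\<^sub>R z) \<le> f x * k (x - 2 *\<^sub>R z)"
      "smax z = sqrt (f x * k (x - 2 *\<^sub>R z))"
      using smax_attained by blast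
    have pos: "0 < f x * k (x - 2 *\<^sub>R z)"
      using that x(1)[of y] by simp
    have "(f u * k (u - z))\<^sup>2 = (f x * k (x - 2 *\<^sub>R z)) * (f (2 *\<^sub>R u - x) * k (2 *\<^sub>R u - x))" for u
      unfolding pointwise_equality[OF int eq x(2) pos] power_mult_distrib
      by (simp add: f.nonneg k.nonneg)
    then show ?thesis
      using x(1) pos by blast
  qed
  obtain w where "w \<in> interior (K \<inter> L)" using int by blast
  then have "0 < f w * k (w - 2 *\<^sub>R 0)"
    using f.pos k.pos by simp
  from rigid[OF this] obtain p where p: "\<forall>y. f y * k (y - 2 *\<^sub>R 0) \<le> f p * k (p - 2 *\<^sub>R 0)"
    "0 < f p * k (p - 2 *\<^sub>R 0)"
    "\<forall>u. (f u * k (u - 0))\<^sup>2 = (f p * k (p - 2 *\<^sub>R 0)) * (f (2 *\<^sub>R u - p) * k (2 *\<^sub>R u - p))"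
    by blast
  have "rigid_pair f k K L p"
  proof
    show "\<exists>x. (\<forall>y. f y * k (y - 2 *\<^sub>R z) \<le> f x * k (x - 2 *\<^sub>R z)) \<and>
        (\<forall>u. (f u * k (u - z))\<^sup>2 =
              (f x * k (x - 2 *\<^sub>R z)) * (f (2 *\<^sub>R u - x) * k (2 *\<^sub>R u - x)))"
      if "0 < f y * k (y - 2 *\<^sub>R z)" for y z
      using rigid[OF that] by blast
  qed (use int p in simp_all)
  then show ?thesis by blast
qed

end

section \<open>Exchange of the two functions and the structure of rigid pairs\<close>

context rigid_pair
begin

text \<open>Translating by \<open>2 z\<close> turns the shift \<open>z\<close> into
  \<open>- z\<close>, so a maximiser \<open>x\<close> becomes \<open>x + 2 z\<close>. This supplies
  the statements for \<open>f\<close> from those proved for \<open>k\<close>.\<close>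

lemma swap_rigid: "rigid_pair k f L K p"
proof -
  interpret sw: log_concave_pair k f L K by (rule swap)
  show ?thesis
  proof
    fix y z assume "0 < k y * f (y - 2 *\<^sub>R z)"
    then have "0 < f (y - 2 *\<^sub>R z) * k ((y - 2 *\<^sub>R z) - 2 *\<^sub>R (- z))"
      by (simp add: mult.commute)
    from rigid[OF this] obtain x where
      x: "\<And>y. f y * k (y + 2 *\<^sub>R z) \<le> f x * k (x + 2 *\<^sub>R z)"
      "\<And>u. (f u * k (u + z))\<^sup>2 = (f x * k (x + 2 *\<^sub>R z)) * (f (2 *\<^sub>R u - x) * k (2 *\<^sub>R u - x))"
      by auto
    have "k y * f (y - 2 *\<^sub>R z) \<le> k (x + 2 *\<^sub>R z) * f (x + 2 *\<^sub>R z - 2 *\<^sub>R z)" for y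
      using x(1)[of "y - 2 *\<^sub>R z"] by (simp add: mult.commute)
    moreover have "(k u * f (u - z))\<^sup>2 = (k (x + 2 *\<^sub>R z) * f (x + 2 *\<^sub>R z - 2 *\<^sub>R z)) *
        (k (2 *\<^sub>R u - (x + 2 *\<^sub>R z)) * f (2 *\<^sub>R u - (x + 2 *\<^sub>R z)))" for u
    proof -
      have "2 *\<^sub>R (u - z) - x = 2 *\<^sub>R u - (x + 2 *\<^sub>R z)"
        by (simp add: algebra_simps)
      from x(2)[of "u - z", unfolded this] show ?thesis
        by (simp add: mult.commute)
    qed
    ultimately show "\<exists>x. (\<forall>y. k y * f (y - 2 *\<^sub>R z) \<le> k x * f (x - 2 *\<^sub>R z)) \<and>
        (\<forall>u. (k u * f (u - z))\<^sup>2 =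
              (k x * f (x - 2 *\<^sub>R z)) * (k (2 *\<^sub>R u - x) * f (2 *\<^sub>R u - x)))"
      by blast
  next
    show "interior (L \<inter> K) \<noteq> {}"
      using interior_Int by (simp add: Int_commute)
    show "0 < k p * f p"
      using peak_pos by (simp add: mult.commute)
    show "k y * f y \<le> k p * f p" for y
      using peak_max[of y] by (simp add: mult.commute)
    show "(k u * f u)\<^sup>2 = (k p * f p) * (k (2 *\<^sub>R u - p) * f (2 *\<^sub>R u - p))" for u
      using peak_eq[of u] by (simp add: mult.commute)
  qed
qed

theorem exponentials_on_simplicial_cone:
  obtains C a b where "simplicial_cone C" "K = L" "K = (\<lambda>x. p + x) ` C" "0 < f p" "0 < k p"
    "\<And>c. c \<in> C \<Longrightarrow> f (p + c) = f p * exp (- (a \<bullet> c))" "\<And>c. c \<in> C \<Longrightarrow> 0 \<le> a \<bullet> c"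
    "\<And>c. c \<in> C \<Longrightarrow> k (p + c) = k p * exp (- (b \<bullet> c))" "\<And>c. c \<in> C \<Longrightarrow> 0 \<le> b \<bullet> c"
proof -
  interpret sw: rigid_pair k f L K p by (rule swap_rigid)
  have sub: "L \<subseteq> K" using sw.K_subset .
  then have KL: "K = L" using K_subset by (rule antisym[rotated])
  have swC: "sw.C = C"
    unfolding C_def sw.C_def by (simp add: Int_commute)
  have mem_C: "c \<in> C \<longleftrightarrow> p + c \<in> K" for c
    unfolding C_def using K_subset by blast
  have K_eq: "K = (\<lambda>x. p + x) ` C"
  proof
    show "K \<subseteq> (\<lambda>x. p + x) ` C"
    proof
      fix x assume "x \<in> K"
      then show "x \<in> (\<lambda>x. p + x) ` C"
        by (intro image_eqI[of _ _ "x - p"]) (simp_all add: mem_C)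
    qed
  qed (use mem_C in auto)
  have f0: "0 < f p" and k0: "0 < k p"
    using f_pos[OF zero_in_C] k_pos[OF zero_in_C] by simp_all
  interpret lattice_cone C
  proof
    show "x = 0" if "x \<in> C" "- x \<in> C" for x
      using k.multiplicative_imp_pointed[OF k0 scale_in_C k_multiplicative that] .
  qed (use closed_C interior_C zero_in_C add_in_C scale_in_C translates_of_C[OF sub] in auto)
  have C: "simplicial_cone C" by (rule simplicial)
  obtain a where "\<And>c. c \<in> C \<Longrightarrow> f (p + c) = f p * exp (- (a \<bullet> c))" "\<And>c. c \<in> C \<Longrightarrow> 0 \<le> a \<bullet> c"
    using f.multiplicative_imp_exponential[OF C add_in_C f_pos sw.k_multiplicative[unfolded swC]] by blast
  moreover obtain b where "\<And>c. c \<in> C \<Longrightarrow> k (p + c) = k p * exp (- (b \<bullet> c))" "\<And>c. c \<in> C \<Longrightarrow> 0 \<le> b \<bullet> c"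
    using k.multiplicative_imp_exponential[OF C add_in_C k_pos k_multiplicative] by blast
  ultimately show thesis
    using that C KL K_eq f0 k0 by blast
qed

end

text \<open>\<open>q z\<close> is the positive part of \<open>z\<close> in the coordinates given by the generators.\<close>

lemma simplicial_cone_positive_part:
  fixes C :: "'a::euclidean_space set"
  assumes "simplicial_cone C"
  obtains q where "\<And>z u. u \<in> C \<and> u - z \<in> C \<longleftrightarrow> u - q z \<in> C" "\<And>z. q (2 *\<^sub>R z) = 2 *\<^sub>R q z"
proof -
  obtain V where V: "independent V" "card V = DIM('a)"
    and CV: "C = {\<Sum>v\<in>V. l v *\<^sub>R v | l. \<forall>v\<in>V. l v \<ge> 0}"
    using assms by (auto simp: simplicial_cone_def)
  have finV: "finite V" using V(1) independent_imp_finite by blast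
  have "UNIV \<subseteq> span V"
    using V by (intro card_ge_dim_independent) auto
  then have span: "x \<in> span V" for x by blast
  define r where "r = representation V"
  have r_sum: "(\<Sum>v\<in>V. r x v *\<^sub>R v) = x" for x
    unfolding r_def using V(1) span finV by (intro sum_representation_eq) auto
  have r_eq: "r (\<Sum>v\<in>V. l v *\<^sub>R v) v = l v" if "v \<in> V" for l v
  proof -
    have "r (\<Sum>v\<in>V. l v *\<^sub>R v) v = (\<Sum>w\<in>V. l w * r w v)"
      unfolding r_def using V(1) span
      by (simp add: representation_sum representation_scale)
    also have "\<dots> = (\<Sum>w\<in>V. if w = v then l w else 0)"
      unfolding r_def using V(1) by (intro sum.cong) (auto simp: representation_basis)
    finally show ?thesis using that finV by simp
  qed
  have mem: "x \<in> C \<longleftrightarrow> (\<forall>v\<in>V. 0 \<le> r x v)" for x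
  proof
    assume "x \<in> C"
    then obtain l where "x = (\<Sum>v\<in>V. l v *\<^sub>R v)" "\<forall>v\<in>V. 0 \<le> l v"
      unfolding CV by blast
    then show "\<forall>v\<in>V. 0 \<le> r x v" using r_eq by simp
  next
    assume "\<forall>v\<in>V. 0 \<le> r x v"
    then show "x \<in> C"
      unfolding CV mem_Collect_eq by (intro exI[of _ "r x"]) (simp add: r_sum)
  qed
  have r_diff: "r (x - y) v = r x v - r y v" for x y v
    unfolding r_def using V(1) span by (simp add: representation_diff)
  define q where "q z = (\<Sum>v\<in>V. max 0 (r z v) *\<^sub>R v)" for z
  show thesis
  proof (rule that[of q])
    fix z u
    show "u \<in> C \<and> u - z \<in> C \<longleftrightarrow> u - q z \<in> C"
      unfolding mem r_diff using r_eq[of _ "\<lambda>v. max 0 (r z v)"] by (auto simp: q_def)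
    have "r (2 *\<^sub>R z) v = 2 * r z v" for v
      unfolding r_def using V(1) span by (simp add: representation_scale)
    then have "q (2 *\<^sub>R z) = (\<Sum>v\<in>V. (2 * max 0 (r z v)) *\<^sub>R v)"
      unfolding q_def by (intro sum.cong) (auto simp: max_def)
    then show "q (2 *\<^sub>R z) = 2 *\<^sub>R q z"
      by (simp add: q_def scaleR_sum_right)
  qed
qed

lemma (in decaying_log_concave) integral_nonzero: "(\<integral>\<^sup>+ x. ennreal (f x) \<partial>lborel) \<noteq> 0"
proof
  assume "(\<integral>\<^sup>+ x. ennreal (f x) \<partial>lborel) = 0"
  then have "AE x in lborel. ennreal (f x) = 0"
    by (subst (asm) nn_integral_0_iff_AE) auto
  then obtain x where "x \<in> interior K" "ennreal (f x) = 0"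
    using AE_lborel_open[OF _ open_interior interior] by blast
  then show False using pos[of x] by simp
qed

section \<open>The inequality and the two directions of the equality case\<close>

context log_concave_pair
begin

lemma integral_smax_mult_overlap:
  "overlap * (\<integral>\<^sup>+ z. ennreal (smax z) \<partial>lborel) = (\<integral>\<^sup>+ z. ennreal (smax z) * overlap \<partial>lborel)"
  by (subst mult.commute, subst nn_integral_multc) simp_all

lemma integral_corr_scaled:
  "(\<integral>\<^sup>+ z. 2 ^ DIM('a) * corr z \<partial>lborel) =
    2 ^ DIM('a) * (\<integral>\<^sup>+ x. ennreal (f x) \<partial>lborel) * (\<integral>\<^sup>+ x. ennreal (k x) \<partial>lborel)"
  by (simp add: nn_integral_cmult integral_corr mult.assoc)

lemma integral_inequality:
  "overlap * (\<integral>\<^sup>+ z. ennreal (smax z) \<partial>lborel) \<le>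
    2 ^ DIM('a) * (\<integral>\<^sup>+ x. ennreal (f x) \<partial>lborel) * (\<integral>\<^sup>+ x. ennreal (k x) \<partial>lborel)"
  unfolding integral_smax_mult_overlap integral_corr_scaled[symmetric]
  by (intro nn_integral_mono smax_mult_overlap_le)

lemma equality_case_imp_rigid:
  assumes "overlap * (\<integral>\<^sup>+ z. ennreal (smax z) \<partial>lborel) =
    2 ^ DIM('a) * (\<integral>\<^sup>+ x. ennreal (f x) \<partial>lborel) * (\<integral>\<^sup>+ x. ennreal (k x) \<partial>lborel)"
  shows "\<exists>p. rigid_pair f k K L p"
proof (rule equality_imp_rigid)
  show "ennreal (smax z) * overlap = 2 ^ DIM('a) * corr z" for z
    using assms by (intro equality_imp_pointwise_equality) (simp add: mult_ac)
  show "overlap \<noteq> 0"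
    using assms f.integral_nonzero k.integral_nonzero by auto
qed

text \<open>With \<open>x\<close> the maximiser, \<open>pointwise\<close> is an equality for every
  \<open>w\<close>; integrating over \<open>w\<close> and \<open>z\<close> gives the claim. Here
  \<open>b\<close> belongs to \<open>k\<close>, so both functionals are nonnegative on
  \<open>C\<close>.\<close>

lemma exponentials_on_simplicial_cone_imp_equality:
  assumes C: "simplicial_cone C" and K: "K = (\<lambda>x. x0 + x) ` C" and L: "L = K"
    and c: "0 < c1" "0 < c2"
    and f: "\<And>x. x \<in> K \<Longrightarrow> f x = c1 * exp (- (a \<bullet> x))"
    and k: "\<And>x. x \<in> K \<Longrightarrow> k x = c2 * exp (- (b \<bullet> x))"
    and ab: "\<And>x. x \<in> C \<Longrightarrow> 0 \<le> a \<bullet> x" "\<And>x. x \<in> C \<Longrightarrow> 0 \<le> b \<bullet> x"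
  shows "overlap * (\<integral>\<^sup>+ z. ennreal (smax z) \<partial>lborel) =
    2 ^ DIM('a) * (\<integral>\<^sup>+ x. ennreal (f x) \<partial>lborel) * (\<integral>\<^sup>+ x. ennreal (k x) \<partial>lborel)"
proof -
  obtain q where q: "\<And>z u. u \<in> C \<and> u - z \<in> C \<longleftrightarrow> u - q z \<in> C" "\<And>z. q (2 *\<^sub>R z) = 2 *\<^sub>R q z"
    using simplicial_cone_positive_part[OF C] by blast
  note scale = simplicial_cone_scale[OF C]
  have mem_K: "x \<in> K \<longleftrightarrow> x - x0 \<in> C" for x
    unfolding K by (auto simp: image_iff intro: bexI[of _ "x - x0"])
  have "C \<noteq> {}" using f.interior interior_subset unfolding K by blast
  then have zero_C: "0 \<in> C" using scale[of _ 0] by auto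
  have both: "u \<in> K \<and> u - z \<in> K \<longleftrightarrow> u - x0 - q z \<in> C" for u z
    using q(1)[of "u - x0" z] by (simp add: mem_K algebra_simps)
  have "ennreal (smax z) * overlap = 2 ^ DIM('a) * corr z" for z
  proof -
    \<comment> \<open>The apex of \<open>K \<inter> (2 z + K)\<close>, since
      \<open>2 q z = q (2 z)\<close>; both exponentials are nonincreasing along \<open>C\<close> and
      hence largest there.\<close>
    define x where "x = x0 + 2 *\<^sub>R q z"
    have xK: "x \<in> K" "x - 2 *\<^sub>R z \<in> K"
      using both[of x "2 *\<^sub>R z"] zero_C by (auto simp: x_def q(2))
    have max: "f y * k (y - 2 *\<^sub>R z) \<le> f x * k (x - 2 *\<^sub>R z)" for y
    proof (cases "y \<in> K \<and> y - 2 *\<^sub>R z \<in> K")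
      case True
      then have "y - x \<in> C"
        using both[of y "2 *\<^sub>R z"] by (simp add: x_def q(2) algebra_simps)
      then have "a \<bullet> x \<le> a \<bullet> y" "b \<bullet> x \<le> b \<bullet> y"
        using ab[of "y - x"] by (auto simp: inner_diff_right)
      then show ?thesis
        using True xK c f k by (auto intro!: mult_mono simp: inner_diff_right)
    next
      case False
      then have "f y * k (y - 2 *\<^sub>R z) = 0"
        using f.zero k.zero L by auto
      then show ?thesis
        using mult_nonneg_nonneg[OF f.nonneg[of x] k.nonneg[of "x - 2 *\<^sub>R z"]] by linarith
    qed
    have eq: "smax z * sqrt (f w * k w) = f ((1/2) *\<^sub>R (x + w)) * k ((1/2) *\<^sub>R (x + w) - z)" for w
    proof -
      define u where "u = (1/2) *\<^sub>R (x + w)"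
      \<comment> \<open>The apex \<open>x0 + q z\<close> of \<open>K \<inter> (z + K)\<close> is the
        midpoint of \<open>x0\<close> and \<open>x\<close>, so relative to it \<open>u\<close> is
        half of \<open>w - x0\<close>; invariance of \<open>C\<close> under scaling matches the
        supports.\<close>
      have "u - x0 - q z = (1/2) *\<^sub>R (w - x0)"
        unfolding u_def x_def by (simp add: algebra_simps) (simp flip: scaleR_add_left)
      then have "u \<in> K \<and> u - z \<in> K \<longleftrightarrow> (1/2) *\<^sub>R (w - x0) \<in> C"
        using both[of u z] by simp
      also have "\<dots> \<longleftrightarrow> w \<in> K"
        unfolding mem_K using scale[of "w - x0" "1/2"] scale[of "(1/2) *\<^sub>R (w - x0)" 2] by auto
      finally have iff: "u \<in> K \<and> u - z \<in> K \<longleftrightarrow> w \<in> K" .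
      show ?thesis
      proof (cases "w \<in> K")
        case True
        then have u: "u \<in> K" "u - z \<in> K" using iff by auto
        have "(f x * k (x - 2 *\<^sub>R z)) * (f w * k w) =
            (c1 * c2)\<^sup>2 * exp (- (a \<bullet> (x + w)) - b \<bullet> (x + w - 2 *\<^sub>R z))"
          using True xK by (simp add: f k power2_eq_square inner_simps algebra_simps flip: exp_add)
        also have "\<dots> = (f u * k (u - z))\<^sup>2"
        proof -
          have "x + w = 2 *\<^sub>R u" by (simp add: u_def)
          then show ?thesis
            using u by (simp add: f k power_mult_distrib inner_simps algebra_simps flip: exp_add exp_double)
        qed
        finally have "sqrt ((f x * k (x - 2 *\<^sub>R z)) * (f w * k w)) = f u * k (u - z)"
          by (simp add: f.nonneg k.nonneg)
        then show ?thesis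
          by (simp add: smax_eq[OF max] real_sqrt_mult u_def)
      next
        case False
        then have "f u * k (u - z) = 0"
          using iff f.zero k.zero L by auto
        then show ?thesis
          using False f.zero by (simp add: u_def)
      qed
    qed
    have "ennreal (smax z) * overlap = (\<integral>\<^sup>+ w. ennreal (smax z * sqrt (f w * k w)) \<partial>lborel)"
      unfolding overlap_def
      by (subst nn_integral_cmult[symmetric]) (auto simp: ennreal_mult smax_nonneg f.nonneg k.nonneg)
    then show ?thesis
      unfolding corr_eq_midpoint[of z x] eq .
  qed
  then show ?thesis
    unfolding integral_smax_mult_overlap integral_corr_scaled[symmetric] by simp
qed

end

text \<open>The integrals are taken in \<open>ennreal\<close>, so the product makes sense before
  anything is known about integrability of \<open>lc_oplus f g\<close>.\<close>

theorem theorem2p6: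
  fixes f g :: "'a::euclidean_space \<Rightarrow> real"
  assumes "log_concave f" and "log_concave g"
    and "integrable lborel f" and "integrable lborel g"
    and "interior (supp f) \<noteq> {}" and "interior (supp g) \<noteq> {}"
    and "continuous_on (supp f) f" and "continuous_on (supp g) g"
  shows "(\<integral>\<^sup>+ x. ennreal (sqrt (f x * refl_fun g x)) \<partial>lborel) *
           (\<integral>\<^sup>+ x. ennreal (lc_oplus f g x) \<partial>lborel)
         \<le> 2 ^ DIM('a) * (\<integral>\<^sup>+ x. ennreal (f x) \<partial>lborel) * (\<integral>\<^sup>+ x. ennreal (g x) \<partial>lborel) \<and>
       ((\<integral>\<^sup>+ x. ennreal (sqrt (f x * refl_fun g x)) \<partial>lborel) *
           (\<integral>\<^sup>+ x. ennreal (lc_oplus f g x) \<partial>lborel)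
         = 2 ^ DIM('a) * (\<integral>\<^sup>+ x. ennreal (f x) \<partial>lborel) * (\<integral>\<^sup>+ x. ennreal (g x) \<partial>lborel)
       \<longleftrightarrow> (\<exists>C x0. simplicial_cone C \<and> supp f = supp (refl_fun g) \<and>
              supp f = (\<lambda>x. x0 + x) ` C \<and>
              (\<exists>c1 c2 a b. c1 > 0 \<and> c2 > 0 \<and>
                 (\<forall>x\<in>supp f. f x = c1 * exp (- inner a x)) \<and>
                 (\<forall>x\<in>supp g. g x = c2 * exp (- inner b x)) \<and>
                 (\<forall>x\<in>C. inner a x \<ge> 0 \<and> 0 \<ge> inner b x))))"
proof -
  define k where "k = refl_fun g"
  interpret f: decaying_log_concave f "supp f"
    by (rule log_concave_decaying) fact+
  interpret k: decaying_log_concave k "supp k"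
    unfolding k_def by (rule refl_fun_decaying) fact+
  interpret log_concave_pair f k "supp f" "supp k" ..
  have [measurable]: "g \<in> borel_measurable borel"
    using assms(4) by auto
  have ov: "(\<integral>\<^sup>+ x. ennreal (sqrt (f x * k x)) \<partial>lborel) = overlap"
    unfolding overlap_def ..
  have sm: "lc_oplus f g z = smax z" for z
    unfolding lc_oplus_def smax_def by (simp add: k_def refl_fun_def)
  have g_int: "(\<integral>\<^sup>+ x. ennreal (g x) \<partial>lborel) = (\<integral>\<^sup>+ x. ennreal (k x) \<partial>lborel)"
    by (subst nn_integral_lborel_affine[of _ "-1" 0]) (simp_all add: k_def refl_fun_def)
  have supp_k: "x \<in> supp g \<longleftrightarrow> - x \<in> supp k" for x
    by (force simp: k_def supp_refl_fun)
  have g_k: "g x = k (- x)" for x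
    by (simp add: k_def refl_fun_def)
  show ?thesis
    unfolding k_def[symmetric] ov sm g_int
  proof (intro conjI iffI integral_inequality)
    assume "overlap * (\<integral>\<^sup>+ x. ennreal (smax x) \<partial>lborel) =
      2 ^ DIM('a) * (\<integral>\<^sup>+ x. ennreal (f x) \<partial>lborel) * (\<integral>\<^sup>+ x. ennreal (k x) \<partial>lborel)"
    then obtain p where "rigid_pair f k (supp f) (supp k) p"
      using equality_case_imp_rigid by blast
    then interpret rigid_pair f k "supp f" "supp k" p .
    obtain C a b where C: "simplicial_cone C" "supp f = supp k" "supp f = (\<lambda>x. p + x) ` C"
      and pos: "0 < f p" "0 < k p"
      and a: "\<And>c. c \<in> C \<Longrightarrow> f (p + c) = f p * exp (- (a \<bullet> c))" "\<And>c. c \<in> C \<Longrightarrow> 0 \<le> a \<bullet> c"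
      and b: "\<And>c. c \<in> C \<Longrightarrow> k (p + c) = k p * exp (- (b \<bullet> c))" "\<And>c. c \<in> C \<Longrightarrow> 0 \<le> b \<bullet> c"
      using exponentials_on_simplicial_cone by blast
    \<comment> \<open>The factors \<open>exp (a \<bullet> p)\<close> and
      \<open>exp (b \<bullet> p)\<close> recentre the exponentials from \<open>p\<close> to the
      origin; \<open>b\<close> changes sign because \<open>g\<close> is the reflection of
      \<open>k\<close>.\<close>
    have "\<forall>x\<in>supp f. f x = (f p * exp (a \<bullet> p)) * exp (- (a \<bullet> x))"
      unfolding C(3) by (auto simp: a inner_add_right simp flip: exp_add)
    moreover have "\<forall>x\<in>supp g. g x = (k p * exp (b \<bullet> p)) * exp (- ((- b) \<bullet> x))"
    proof
      fix x assume "x \<in> supp g"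
      then have "- x \<in> (\<lambda>x. p + x) ` C"
        using C(2,3) supp_k by simp
      then obtain c where c: "c \<in> C" "- x = p + c"
        by blast
      then have "b \<bullet> c = - (b \<bullet> x) - b \<bullet> p"
        by (metis add_diff_cancel_left' inner_diff_right inner_minus_right)
      then show "g x = (k p * exp (b \<bullet> p)) * exp (- ((- b) \<bullet> x))"
        using b(1)[OF c(1)] by (simp add: g_k c(2) flip: exp_add)
    qed
    moreover have "\<forall>x\<in>C. a \<bullet> x \<ge> 0 \<and> 0 \<ge> (- b) \<bullet> x"
      using a(2) b(2) by simp
    moreover have "0 < f p * exp (a \<bullet> p)" "0 < k p * exp (b \<bullet> p)"
      using pos by simp_all
    ultimately show "\<exists>C x0. simplicial_cone C \<and> supp f = supp k \<and> supp f = (\<lambda>x. x0 + x) ` C \<and>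
        (\<exists>c1 c2 a b. c1 > 0 \<and> c2 > 0 \<and> (\<forall>x\<in>supp f. f x = c1 * exp (- inner a x)) \<and>
           (\<forall>x\<in>supp g. g x = c2 * exp (- inner b x)) \<and> (\<forall>x\<in>C. inner a x \<ge> 0 \<and> 0 \<ge> inner b x))"
      using C by blast
  next
    assume "\<exists>C x0. simplicial_cone C \<and> supp f = supp k \<and> supp f = (\<lambda>x. x0 + x) ` C \<and>
        (\<exists>c1 c2 a b. c1 > 0 \<and> c2 > 0 \<and> (\<forall>x\<in>supp f. f x = c1 * exp (- inner a x)) \<and>
           (\<forall>x\<in>supp g. g x = c2 * exp (- inner b x)) \<and> (\<forall>x\<in>C. inner a x \<ge> 0 \<and> 0 \<ge> inner b x))"
    then obtain C x0 c1 c2 a b where C: "simplicial_cone C" "supp f = (\<lambda>x. x0 + x) ` C" "supp k = supp f"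
      and c: "c1 > 0" "c2 > 0" and f: "\<forall>x\<in>supp f. f x = c1 * exp (- (a \<bullet> x))"
      and g: "\<forall>x\<in>supp g. g x = c2 * exp (- (b \<bullet> x))" and ab: "\<forall>x\<in>C. a \<bullet> x \<ge> 0 \<and> 0 \<ge> b \<bullet> x"
      by metis
    have "k x = c2 * exp (- ((- b) \<bullet> x))" if "x \<in> supp f" for x
      using g[rule_format, of "- x"] that C(3) supp_k[of "- x"] g_k[of "- x"] by simp
    then show "overlap * (\<integral>\<^sup>+ x. ennreal (smax x) \<partial>lborel) =
      2 ^ DIM('a) * (\<integral>\<^sup>+ x. ennreal (f x) \<partial>lborel) * (\<integral>\<^sup>+ x. ennreal (k x) \<partial>lborel)"
      using f ab by (intro exponentials_on_simplicial_cone_imp_equality[OF C c, of a "- b"]) auto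
  qed
qed

end
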